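(* Let $X=(X_t,P^x)$ and $Y=(Y_t,Q^x)$ be conservative Borel right Markov processes with càdlàg paths on the same state space $E$, each satisfying the duality hypothesis (D) and the transition density hypothesis (T) of the context, with reference measures $m^X,m^Y$, transition densities $p_t(x,y),q_t(x,y)$, dual processes $\hat X=(\hat X_t,\hat P^x)$, $\hat Y=(\hat Y_t,\hat Q^x)$ and bridge laws $P^{x,y}_t$, $Q^{x,y}_t$. Suppose in addition that for each $t>0$ the functions $p_t(x,y)$ and $q_t(x,y)$ are separately continuous in the spatial variables $x$ and $y$. If there is a triple $(x_0,t_0,y_0)\in E\times(0,\infty)\times E$ such that $P^{x_0,y_0}_{t_0}=Q^{x_0,y_0}_{t_0}$, then: (a) $P^x|_{\mathcal F_t}\sim Q^x|_{\mathcal F_t}$ and $\hat P^y|_{\mathcal F_t}\sim\hat Q^y|_{\mathcal F_t}$ (mutual absolute continuity) for all $x\in E$, $y\in E$ and $t>0$. (b) There exist a constant $\lambda\in\mathbb R$, a Borel finely continuous function $\psi:E\to(0,\infty)$, and a Borel co-finely continuous function $\hat\psi:E\to(0,\infty)$ such that for all $t>0$ and all $x\in E$, $$P_t\psi(x)=e^{\lambda t}\psi(x),\qquad \hat P_t\hat\psi(x)=e^{\lambda t}\hat\psi(x),$$ $$Q^x|_{\mathcal F_t}=e^{-\lambda t}\frac{\psi(X_t)}{\psi(X_0)}\,P^x|_{\mathcal F_t},\qquad \hat Q^x|_{\mathcal F_t}=e^{-\lambda t}\frac{\hat\psi(X_t)}{\hat\psi(X_0)}\,\hat P^x|_{\mathcal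 F_t},$$ and the function $\psi\hat\psi$ is a Borel version of the Radon–Nikodym derivative $dm^Y/dm^X$. (c) $Q^{x,y}_t=P^{x,y}_t$ for all $(x,t,y)\in E\times(0,\infty)\times E$.
   Context: Setting. $E$ is a space homeomorphic to a Borel subset of a compact metric space, with Borel $\sigma$-algebra $\mathcal E$. $\Omega$ is the set of all càdlàg paths $\omega:[0,\infty)\to E$, $X_t(\omega)=\omega(t)$ is the coordinate process, $\mathcal F_t=\sigma(X_s:0\le s\le t)$ (uncompleted), $\mathcal F_{t-}=\sigma(X_s:0\le s<t)$, and $\theta_t$ are the shifts, $X_s\circ\theta_t=X_{s+t}$. All processes considered (including the dual processes) are realized as the coordinate process on $\Omega$ (so $Y_t$, $\hat X_t$, $\hat Y_t$ are also the coordinate maps), under different families of laws. A conservative Borel right process with càdlàg paths, $X=(X_t,P^x)$, is a time-homogeneous strong Markov process given by probability laws $P^x$, $x\in E$, on $\Omega$ with $P^x(X_0=x)=1$ (no branch points), infinite lifetime, and transition semigroup $P_tf(x)=P^x(f(X_t))$ mapping bounded Borel functions to Borel functions. (Here $P^x(\cdot)$ applied to a function denotes expectation.) Hypothesis (D) (duality) for $X$: there are a $\sigma$-finite measure $m^X$ on $(E,\mathcal E)$ and a second $E$-valued conservative Borel right process $\hat X$ with càdlàg paths, with laws $\hat P^x$ and semigroup $(\hat P_t)$, such that $\int_E f\,P_tg\,dm^X=\int_E(\hat P_tf)\,g\,dm^X$ for all $t>0$ and all positive $\mathcal E$-measurable $f,g$. Hypothesis (T) (transition densities) for $X$: there is a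 jointly Borel measurable function $(x,t,y)\mapsto p_t(x,y)\in(0,\infty)$ on $E\times(0,\infty)\times E$ such that for all $t>0$, $x\in E$ and bounded Borel $f$, $P_tf(x)=\int_E p_t(x,y)f(y)\,m^X(dy)$ and $\hat P_tf(x)=\int_E p_t(y,x)f(y)\,m^X(dy)$, and $p_{t+s}(x,y)=\int_E p_t(x,z)p_s(z,y)\,m^X(dz)$ for all $s,t>0$, $x,y\in E$. $Y$ satisfies the same conditions, with laws $Q^x$, semigroup $(Q_t)$, reference measure $m^Y$, density $q_t(x,y)$ (with respect to $m^Y$), dual process $\hat Y$ and dual laws $\hat Q^x$. Bridge laws: for $(x,t,y)\in E\times(0,\infty)\times E$, $P^{x,y}_t$ is the unique probability measure on $(\Omega,\mathcal F_{t-})$ such that $P^{x,y}_t(F)=P^x\!\left(F\,\frac{p_{t-s}(X_s,y)}{p_t(x,y)}\right)$ for all $0\le s<t$ and all positive $\mathcal F_s$-measurable $F$ (its existence and uniqueness are known; it is a regular version of the law of $(X_s)_{0\le s<t}$ under $P^x$ conditioned on $X_t=y$). $Q^{x,y}_t$ is defined in the same way from $Q^x$ and $q_t$. A Borel function $f$ on $E$ is finely continuous (for $X$) if $t\mapsto f(X_t)$ is right-continuous $P^x$-a.s. for every $x\in E$; co-finely continuous means finely continuous for the dual process $\hat X$ (that is, with $\hat P^x$ in place of $P^x$). *)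

theory Defs
  imports "HOL-Probability.Probability"
begin

section \<open>Path space\<close>

text \<open>
  Paths on $[0,\infty)$ are represented by functions on the reals that are
  \<open>undefined\<close> at negative times, so that a path is determined by its values at
  nonnegative times.
\<close>

definition cadlag_paths :: "(real \<Rightarrow> 'e::topological_space) set" where
  "cadlag_paths = {\<omega> \<in> extensional {0..}.
     (\<forall>t\<ge>0. (\<omega> \<longlongrightarrow> \<omega> t) (at_right t)) \<and>
     (\<forall>t>0. \<exists>l. (\<omega> \<longlongrightarrow> l) (at_left t))}"

text \<open>
  \<open>path_sigma I\<close> is $\sigma(X_s : s \in I)$ for the coordinate process $X$. Thus
  $\mathcal F_t$ is \<open>path_sigma {0..t}\<close>, $\mathcal F_{t-}$ is \<open>path_sigma {0..<t}\<close>, and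
  $\mathcal F_\infty$ is \<open>path_sigma {0..}\<close>.
\<close>

definition path_sigma :: "real set \<Rightarrow> (real \<Rightarrow> 'e::topological_space) measure" where
  "path_sigma I = sigma cadlag_paths
     {(\<lambda>\<omega>. \<omega> s) -` A \<inter> cadlag_paths | s A. s \<in> I \<and> A \<in> sets borel}"

definition path_shift :: "real \<Rightarrow> (real \<Rightarrow> 'e) \<Rightarrow> real \<Rightarrow> 'e" where
  "path_shift t \<omega> = (\<lambda>s\<in>{0..}. \<omega> (s + t))"

text \<open>
  The right-continuous filtration $\mathcal F_{t+}$, indexed by $[0,\infty]$ so that it
  can be used with stopping times taking the value $\infty$. At \<open>t = \<infinity>\<close> the
  intersection over \<open>s\<close> is empty and the value is $\mathcal F_\infty$.
\<close>

definition path_filt_plus :: "ennreal \<Rightarrow> (real \<Rightarrow> 'e::topological_space) measure" where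
  "path_filt_plus t = sigma cadlag_paths
     (sets (path_sigma {0..}) \<inter> (\<Inter>s\<in>{s. t < ennreal s}. sets (path_sigma {0..s})))"

lemma space_path_sigma [simp]: "space (path_sigma I) = cadlag_paths"
  unfolding path_sigma_def by (rule space_measure_of) auto

lemma sets_path_filt_plus:
  "sets (path_filt_plus t :: (real \<Rightarrow> 'e::topological_space) measure) =
     sets (path_sigma {0..}) \<inter> (\<Inter>s\<in>{s. t < ennreal s}. sets (path_sigma {0..s}))"
proof -
  let ?I = "sets (path_sigma {0..} :: (real \<Rightarrow> 'e) measure) \<inter>
              (\<Inter>s\<in>{s. t < ennreal s}. sets (path_sigma {0..s}))"
  have compl: "cadlag_paths - A \<in> sets (path_sigma J)" if "A \<in> sets (path_sigma J)"
    for A :: "(real \<Rightarrow> 'e) set" and J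
    using sets.compl_sets[OF that] by simp
  have "sigma_algebra cadlag_paths ?I"
    unfolding sigma_algebra_iff2
  proof (intro conjI allI ballI impI)
    show "?I \<subseteq> Pow cadlag_paths"
      using sets.space_closed[of "path_sigma {0..} :: (real \<Rightarrow> 'e) measure"] by auto
    show "{} \<in> ?I" by simp
    show "cadlag_paths - A \<in> ?I" if "A \<in> ?I" for A
      using that by (simp add: compl)
    show "(\<Union>i. A i) \<in> ?I" if "range A \<subseteq> ?I" for A :: "nat \<Rightarrow> (real \<Rightarrow> 'e) set"
    proof -
      have "A i \<in> ?I" for i using that by (rule range_subsetD)
      then show ?thesis
        by (intro IntI INT_I sets.countable_UN) auto
    qed
  qed
  then show ?thesis
    unfolding path_filt_plus_def by (simp only: sigma_algebra.sets_measure_of_eq)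
qed

lemma filtration_path_filt_plus:
  "filtration (cadlag_paths :: (real \<Rightarrow> 'e::topological_space) set) path_filt_plus"
proof
  fix i j :: ennreal
  show "space (path_filt_plus i :: (real \<Rightarrow> 'e) measure) = cadlag_paths"
    unfolding path_filt_plus_def
    using sets.space_closed[of "path_sigma {0..} :: (real \<Rightarrow> 'e) measure"]
    by (intro space_measure_of) auto
  assume "i \<le> j"
  then show "sets (path_filt_plus i :: (real \<Rightarrow> 'e) measure) \<le> sets (path_filt_plus j)"
    unfolding sets_path_filt_plus by (auto dest: le_less_trans)
qed


section \<open>Right processes\<close>

text \<open>
  A process is given by its family \<open>P\<close> of laws on path space. Its transition semigroup
  acts on bounded Borel functions (\<open>semigroup_op\<close>) and on positive measurable functions
  (\<open>nn_semigroup_op\<close>).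
\<close>

definition semigroup_op ::
  "('e \<Rightarrow> (real \<Rightarrow> 'e) measure) \<Rightarrow> real \<Rightarrow> ('e \<Rightarrow> real) \<Rightarrow> 'e \<Rightarrow> real" where
  "semigroup_op P t f x = (\<integral>\<omega>. f (\<omega> t) \<partial>P x)"

definition nn_semigroup_op ::
  "('e \<Rightarrow> (real \<Rightarrow> 'e) measure) \<Rightarrow> real \<Rightarrow> ('e \<Rightarrow> ennreal) \<Rightarrow> 'e \<Rightarrow> ennreal" where
  "nn_semigroup_op P t f x = (\<integral>\<^sup>+\<omega>. f (\<omega> t) \<partial>P x)"

text \<open>
  Strong Markov property at all $\mathcal F_{t+}$-stopping times $T$, with values in
  $[0,\infty]$: for positive $\mathcal F_\infty$-measurable $G$,
  $P^x(G\circ\theta_T \mid \mathcal F_{T+}) = P^{X_T}(G)$ on $\{T<\infty\}$.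
\<close>

definition strong_markov ::
  "('e::topological_space \<Rightarrow> (real \<Rightarrow> 'e) measure) \<Rightarrow> bool" where
  "strong_markov P \<longleftrightarrow>
     (\<forall>x T A G.
        stopping_time path_filt_plus T \<longrightarrow>
        A \<in> sets (filtration.pre_sigma cadlag_paths path_filt_plus T) \<longrightarrow>
        G \<in> borel_measurable (path_sigma {0..}) \<longrightarrow>
        (\<integral>\<^sup>+\<omega>. G (path_shift (enn2real (T \<omega>)) \<omega>) * indicator {\<omega>\<in>A. T \<omega> < \<infinity>} \<omega> \<partial>P x) =
        (\<integral>\<^sup>+\<omega>. (\<integral>\<^sup>+\<eta>. (G \<eta> :: ennreal) \<partial>P (\<omega> (enn2real (T \<omega>))))
               * indicator {\<omega>\<in>A. T \<omega> < \<infinity>} \<omega> \<partial>P x))"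

definition borel_right_process ::
  "('e::topological_space \<Rightarrow> (real \<Rightarrow> 'e) measure) \<Rightarrow> bool" where
  "borel_right_process P \<longleftrightarrow>
     (\<forall>x. prob_space (P x) \<and> sets (P x) = sets (path_sigma {0..})) \<and>
     (\<forall>x. AE \<omega> in P x. \<omega> 0 = x) \<and>
     (\<forall>t\<ge>0. \<forall>f. f \<in> borel_measurable borel \<and> bounded (range f) \<longrightarrow>
        semigroup_op P t f \<in> borel_measurable borel) \<and>
     strong_markov P"

definition finely_continuous ::
  "('e \<Rightarrow> (real \<Rightarrow> 'e) measure) \<Rightarrow> ('e \<Rightarrow> real) \<Rightarrow> bool" where
  "finely_continuous P f \<longleftrightarrow>
     (\<forall>x. AE \<omega> in P x. \<forall>t\<ge>0. ((\<lambda>s. f (\<omega> s)) \<longlongrightarrow> f (\<omega> t)) (at_right t))"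


section \<open>Duality, transition densities and bridges\<close>

definition duality_hyp ::
  "('e::topological_space \<Rightarrow> (real \<Rightarrow> 'e) measure) \<Rightarrow> ('e \<Rightarrow> (real \<Rightarrow> 'e) measure) \<Rightarrow>
   'e measure \<Rightarrow> bool" where
  "duality_hyp P P' m \<longleftrightarrow>
     sets m = sets borel \<and> sigma_finite_measure m \<and> borel_right_process P' \<and>
     (\<forall>t>0. \<forall>f g. f \<in> borel_measurable borel \<longrightarrow> g \<in> borel_measurable borel \<longrightarrow>
        (\<integral>\<^sup>+x. f x * nn_semigroup_op P t g x \<partial>m) = (\<integral>\<^sup>+x. nn_semigroup_op P' t f x * g x \<partial>m))"

definition transition_density_hyp ::
  "('e::topological_space \<Rightarrow> (real \<Rightarrow> 'e) measure) \<Rightarrow> ('e \<Rightarrow> (real \<Rightarrow> 'e) measure) \<Rightarrow>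
   'e measure \<Rightarrow> (real \<Rightarrow> 'e \<Rightarrow> 'e \<Rightarrow> real) \<Rightarrow> bool" where
  "transition_density_hyp P P' m p \<longleftrightarrow>
     (\<lambda>(x, t, y). p t x y)
        \<in> borel_measurable (borel \<Otimes>\<^sub>M (restrict_space borel {0<..} \<Otimes>\<^sub>M borel)) \<and>
     (\<forall>t>0. \<forall>x y. 0 < p t x y) \<and>
     (\<forall>t>0. \<forall>x f. f \<in> borel_measurable borel \<and> bounded (range f) \<longrightarrow>
        semigroup_op P t f x = (\<integral>y. p t x y * f y \<partial>m) \<and>
        semigroup_op P' t f x = (\<integral>y. p t y x * f y \<partial>m)) \<and>
     (\<forall>s>0. \<forall>t>0. \<forall>x y.
        ennreal (p (t + s) x y) = (\<integral>\<^sup>+z. ennreal (p t x z * p s z y) \<partial>m))"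

definition is_bridge_law ::
  "('e::topological_space \<Rightarrow> (real \<Rightarrow> 'e) measure) \<Rightarrow> (real \<Rightarrow> 'e \<Rightarrow> 'e \<Rightarrow> real) \<Rightarrow>
   'e \<Rightarrow> real \<Rightarrow> 'e \<Rightarrow> (real \<Rightarrow> 'e) measure \<Rightarrow> bool" where
  "is_bridge_law P p x t y B \<longleftrightarrow>
     prob_space B \<and> sets B = sets (path_sigma {0..<t}) \<and>
     (\<forall>s F. 0 \<le> s \<longrightarrow> s < t \<longrightarrow> F \<in> borel_measurable (path_sigma {0..s}) \<longrightarrow>
        (\<integral>\<^sup>+\<omega>. F \<omega> \<partial>B) = (\<integral>\<^sup>+\<omega>. F \<omega> * ennreal (p (t - s) (\<omega> s) y / p t x y) \<partial>P x))"


section \<open>Relations between laws\<close>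

definition mutually_abs_continuous :: "'a measure \<Rightarrow> 'a measure \<Rightarrow> bool" where
  "mutually_abs_continuous M N \<longleftrightarrow> absolutely_continuous M N \<and> absolutely_continuous N M"

end

(*
  At intermediate times s < u < t0 the common bridge has the joint density
  p_s(x0,x) p_{u-s}(x,y) p_{t0-u}(y,y0) / p_{t0}(x0,y0) with respect to m^X x m^X, and likewise
  with q and m^Y.  Its one-time marginals give m^Y = h m^X with h continuous and positive; its
  two-time marginals then identify the densities almost everywhere, hence everywhere, because the
  densities are separately continuous and m^X charges every nonempty open set (paths are
  right-continuous).  With r = q/p this reads
      r_{s+u}(x0,y) = r_s(x0,x) h(x) r_u(x,y),
  which forces r_u(x,y) h(y) = g(u) psi(y)/psi(x) with psi continuous and g multiplicative on
  (0,t0).  Fatou's lemma for P_u psi = psi/g(u) as u -> 0 makes g exponential, and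
  Chapman-Kolmogorov extends the identity from short times to all times.  So Q is the h-transform
  of P by psi, the dual of Q that of the dual of P by h/psi, and both functions are continuous,
  hence finely continuous along cadlag paths.
*)
theory Submission
  imports Defs
begin

section \<open>Path measures\<close>

text \<open>The bridge fixes only ratios tied to the endpoints \<open>x0\<close> and
  \<open>y0\<close>, while the conclusion concerns all starting points. The factor ending at
  \<open>y0\<close> is removed by comparing the one-time density at s+u with the two-time density at
  s and s+u. In the resulting relation for r, freezing the target shows that r_s(x0,.) depends on s
  only through a scalar. One slice, at an arbitrary reference time, therefore carries all the
  spatial information: t0/2 is taken, and psi is h times that slice. Since one argument is frozen in
  each factor, separate continuity is enough to make psi continuous.

  This one-sided bound suffices: after subtraction of a linear function, -log g is periodic with
  arbitrarily small periods, so the bound spreads from 0 to the whole interval, and a reflection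
  turns it into equality.

  The dual needs no second argument: the final kernel identity keeps its form, with the same h and
  the same rate, when p and q are transposed and psi is replaced by h/psi.\<close>

lemma measurable_path_eval [measurable]:
  "s \<in> I \<Longrightarrow> (\<lambda>\<omega>. \<omega> s) \<in> measurable (path_sigma I :: (real \<Rightarrow> 'e::topological_space) measure) borel"
proof (rule measurableI)
  fix A :: "'e set" assume "s \<in> I" "A \<in> sets borel"
  then have "(\<lambda>\<omega>. \<omega> s) -` A \<inter> cadlag_paths \<in>
      {(\<lambda>\<omega>. \<omega> s) -` A \<inter> cadlag_paths | s A. s \<in> I \<and> A \<in> sets borel}"
    by blast
  then show "(\<lambda>\<omega>. \<omega> s) -` A \<inter> space (path_sigma I) \<in> sets (path_sigma I)"
    unfolding space_path_sigma unfolding path_sigma_def by (rule in_measure_of[rotated]) auto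
qed simp

definition path_cylinder :: "real set \<Rightarrow> (real \<Rightarrow> 'e set) \<Rightarrow> (real \<Rightarrow> 'e::topological_space) set" where
  "path_cylinder J A = {\<omega> \<in> cadlag_paths. \<forall>j\<in>J. \<omega> j \<in> A j}"

lemma path_cylinder_sets [measurable]:
  assumes "finite J" "J \<subseteq> I" "\<And>j. A j \<in> sets borel"
  shows "path_cylinder J A \<in> sets (path_sigma I)"
proof -
  have "path_cylinder J A = (\<Inter>j\<in>J. {\<omega> \<in> space (path_sigma I). \<omega> j \<in> A j}) \<inter> space (path_sigma I)"
    by (auto simp: path_cylinder_def)
  also have "\<dots> \<in> sets (path_sigma I)"
  proof (cases "J = {}")
    case False
    have "{\<omega> \<in> space (path_sigma I). \<omega> j \<in> A j} \<in> sets (path_sigma I)" if "j \<in> J" for j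
      using measurable_sets[OF measurable_path_eval assms(3), of j I j] that assms(2)
      by (auto simp: vimage_def Int_def conj_commute)
    then show ?thesis using False assms(1)
      using sets.top[of "path_sigma I"] by (intro sets.Int sets.finite_INT) auto
  qed (use sets.top[of "path_sigma I"] in simp)
  finally show ?thesis .
qed

lemma sets_path_sigma_cylinders:
  "sets (path_sigma I :: (real \<Rightarrow> 'e::topological_space) measure) = sigma_sets cadlag_paths
     {path_cylinder J A | J A. finite J \<and> J \<subseteq> I \<and> (\<forall>j. A j \<in> sets borel)}"
    (is "_ = sigma_sets _ ?E")
proof
  have *: "sets (path_sigma I :: (real \<Rightarrow> 'e) measure) = sigma_sets cadlag_paths
     {(\<lambda>\<omega>. \<omega> s) -` A \<inter> cadlag_paths | s A. s \<in> I \<and> A \<in> sets borel}"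
    unfolding path_sigma_def by (rule sets_measure_of) auto
  show "sets (path_sigma I) \<subseteq> sigma_sets cadlag_paths ?E"
    unfolding *
  proof (rule sigma_sets_mono, safe)
    fix s and A :: "'e set" assume "s \<in> I" "A \<in> sets borel"
    moreover have "(\<lambda>\<omega>. \<omega> s) -` A \<inter> cadlag_paths = path_cylinder {s} (\<lambda>_. A)"
      by (auto simp: path_cylinder_def)
    ultimately show "(\<lambda>\<omega>. \<omega> s) -` A \<inter> cadlag_paths \<in> sigma_sets cadlag_paths ?E"
      by (intro sigma_sets.Basic) (auto intro!: exI[of _ "{s}"])
  qed
  have "?E \<subseteq> sets (path_sigma I)"
    by auto
  from sets.sigma_sets_subset[OF this]
  show "sigma_sets cadlag_paths ?E \<subseteq> sets (path_sigma I)"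
    by simp
qed

text \<open>Cylinders form a pi-system generating the sigma-algebra. The whole path space is the
  cylinder over the empty index set, so both measures have the same total mass and finiteness of one
  of them is enough.\<close>

lemma path_measure_eqI:
  fixes M N :: "(real \<Rightarrow> 'e::topological_space) measure"
  assumes M: "sets M = sets (path_sigma I)" "finite_measure M"
    and N: "sets N = sets (path_sigma I)"
    and eq: "\<And>J A. finite J \<Longrightarrow> J \<subseteq> I \<Longrightarrow> (\<And>j. A j \<in> sets borel) \<Longrightarrow>
       emeasure M (path_cylinder J A) = emeasure N (path_cylinder J A)"
  shows "M = N"
proof -
  let ?E = "{path_cylinder J A :: (real \<Rightarrow> 'e) set | J A. finite J \<and> J \<subseteq> I \<and> (\<forall>j. A j \<in> sets borel)}"
  show ?thesis
  proof (rule measure_eqI_generator_eq[where E = ?E and \<Omega> = cadlag_paths and A = "\<lambda>_. cadlag_paths"])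
    show "Int_stable ?E"
    proof (rule Int_stableI, safe)
      fix J J' and A A' :: "real \<Rightarrow> 'e set"
      assume *: "finite J" "finite J'" "J \<subseteq> I" "J' \<subseteq> I" "\<forall>j. A j \<in> sets borel" "\<forall>j. A' j \<in> sets borel"
      \<comment> \<open>Padding each family with \<open>UNIV\<close> outside its index set makes the
        intersection a cylinder over the union of the index sets.\<close>
      define C where "C j = (if j \<in> J then A j else UNIV) \<inter> (if j \<in> J' then A' j else UNIV)" for j
      have "path_cylinder J A \<inter> path_cylinder J' A' = path_cylinder (J \<union> J') C"
        by (auto simp: path_cylinder_def C_def)
      moreover have "C j \<in> sets borel" for j using * by (auto simp: C_def)
      ultimately show "\<exists>K D. path_cylinder J A \<inter> path_cylinder J' A' = path_cylinder K D \<and>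
          finite K \<and> K \<subseteq> I \<and> (\<forall>j. D j \<in> sets borel)"
        using * by (intro exI[of _ "J \<union> J'"] exI[of _ C]) auto
    qed
    have "(cadlag_paths :: (real \<Rightarrow> 'e) set) = path_cylinder {} (\<lambda>_. UNIV)"
      by (simp add: path_cylinder_def)
    then show "range (\<lambda>_. cadlag_paths) \<subseteq> ?E"
      by (auto intro!: exI[of _ "{}"] exI[of _ "\<lambda>_. UNIV"])
    show "emeasure M cadlag_paths \<noteq> \<infinity>"
      using finite_measure.emeasure_finite[OF M(2)] by simp
  qed (use M N eq in \<open>auto simp: sets_path_sigma_cylinders path_cylinder_def\<close>)
qed

lemma sets_path_sigma_mono: "I \<subseteq> J \<Longrightarrow> sets (path_sigma I) \<subseteq> sets (path_sigma J)"
  unfolding sets_path_sigma_cylinders by (rule sigma_sets_mono') blast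

section \<open>Right processes: Markov property at fixed times and behaviour at time zero\<close>

lemma borel_right_process_sets: "borel_right_process P \<Longrightarrow> sets (P x) = sets (path_sigma {0..})"
  by (simp add: borel_right_process_def)

lemma borel_right_process_space: "borel_right_process P \<Longrightarrow> space (P x) = cadlag_paths"
  using sets_eq_imp_space_eq[OF borel_right_process_sets, of P x] by simp

lemma subalgebra_path_sigma:
  "borel_right_process P \<Longrightarrow> I \<subseteq> {0..} \<Longrightarrow> subalgebra (P x) (path_sigma I)"
  using sets_path_sigma_mono[of I "{0..}"]
  by (auto simp: subalgebra_def borel_right_process_space borel_right_process_sets)

lemma measurable_borel_right_process:
  assumes "borel_right_process P" "0 \<le> t"
  shows "(\<lambda>\<omega>. \<omega> t) \<in> measurable (P x) borel"
proof -
  have "(\<lambda>\<omega>. \<omega> t) \<in> measurable (path_sigma {0..}) borel"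
    using assms(2) by (intro measurable_path_eval) auto
  then show ?thesis
    by (subst measurable_cong_sets[OF borel_right_process_sets[OF assms(1)] refl])
qed

text \<open>This is the strong Markov property at the deterministic time \<open>s\<close>: an event
  of F_s lies in F_{s+}, and the shift turns X_t into X_{t+s}.\<close>

lemma borel_right_process_markov:
  assumes P: "borel_right_process P" and st: "0 \<le> s" "0 \<le> t"
    and A: "A \<in> sets (path_sigma {0..s})" and f: "f \<in> borel_measurable borel"
  shows "(\<integral>\<^sup>+\<omega>. f (\<omega> (t + s)) * indicator A \<omega> \<partial>P x) =
         (\<integral>\<^sup>+\<omega>. nn_semigroup_op P t f (\<omega> s) * indicator A \<omega> \<partial>P x)"
proof -
  interpret F: filtration cadlag_paths path_filt_plus
    by (rule filtration_path_filt_plus)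
  have "A \<in> sets (F.pre_sigma (\<lambda>_. ennreal s))"
  proof (rule F.sets_pre_sigmaI[OF stopping_time_const])
    fix u :: ennreal
    have "A \<in> sets (path_filt_plus (ennreal s))"
      unfolding sets_path_filt_plus
    proof (intro IntI INT_I)
      show "A \<in> sets (path_sigma {0..})"
        using A sets_path_sigma_mono[of "{0..s}" "{0..}"] by auto
      fix v assume "v \<in> {v. ennreal s < ennreal v}"
      then have "s \<le> v" using st by (metis ennreal_leI leD linear mem_Collect_eq)
      then show "A \<in> sets (path_sigma {0..v})"
        using A sets_path_sigma_mono[of "{0..s}" "{0..v}"] by auto
    qed
    with F.sets_F_mono[of "ennreal s" u]
    show "{\<omega> \<in> A. ennreal s \<le> u} \<in> sets (path_filt_plus u)"
      by (cases "ennreal s \<le> u") auto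
  qed
  moreover have "(\<lambda>\<omega>. f (\<omega> t)) \<in> borel_measurable (path_sigma {0..})"
    using st by (intro measurable_compose[OF measurable_path_eval f]) auto
  ultimately have
    "(\<integral>\<^sup>+\<omega>. f (path_shift (enn2real (ennreal s)) \<omega> t) * indicator {\<omega>\<in>A. ennreal s < \<infinity>} \<omega> \<partial>P x) =
     (\<integral>\<^sup>+\<omega>. (\<integral>\<^sup>+\<eta>. f (\<eta> t) \<partial>P (\<omega> (enn2real (ennreal s)))) * indicator {\<omega>\<in>A. ennreal s < \<infinity>} \<omega> \<partial>P x)"
    using P stopping_time_const[of path_filt_plus "ennreal s"]
    unfolding borel_right_process_def strong_markov_def by blast
  then show ?thesis
    using st by (simp add: path_shift_def nn_semigroup_op_def)
qed

text \<open>Paths start at x and are right-continuous there, so f(X_u) tends to f(x) almost surely;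
  Fatou does the rest. Without a bound on \<open>f\<close>, only this inequality can be
  expected.\<close>

lemma borel_right_process_liminf:
  fixes f :: "'e::topological_space \<Rightarrow> real"
  assumes P: "borel_right_process P" and f: "continuous_on UNIV f"
    and u: "u \<longlonglongrightarrow> 0" "\<And>n. 0 < u n"
  shows "ennreal (f x) \<le> liminf (\<lambda>n. nn_semigroup_op P (u n) (\<lambda>z. ennreal (f z)) x)"
proof -
  interpret prob_space "P x" using P by (simp add: borel_right_process_def)
  have [measurable]: "f \<in> borel_measurable borel"
    using f by (rule borel_measurable_continuous_onI)
  have "AE \<omega> in P x. \<omega> 0 = x" using P by (simp add: borel_right_process_def)
  moreover have "AE \<omega> in P x. \<omega> \<in> cadlag_paths"
    using AE_space[of "P x"] by (simp add: borel_right_process_space[OF P])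
  ultimately have "AE \<omega> in P x. liminf (\<lambda>n. ennreal (f (\<omega> (u n)))) = ennreal (f x)"
  proof eventually_elim
    case (elim \<omega>)
    have "\<forall>t\<ge>0. (\<omega> \<longlongrightarrow> \<omega> t) (at_right t)" using elim by (simp add: cadlag_paths_def)
    then have "(\<omega> \<longlongrightarrow> x) (at_right 0)" using elim by force
    moreover have "filterlim u (at_right 0) sequentially"
      using u by (auto simp: filterlim_at intro!: eventuallyI less_imp_neq[THEN not_sym])
    ultimately have "(\<lambda>n. \<omega> (u n)) \<longlonglongrightarrow> x"
      using elim filterlim_compose by blast
    then have "(\<lambda>n. f (\<omega> (u n))) \<longlonglongrightarrow> f x"
      using f continuous_on_tendsto_compose[OF f] by auto
    then show ?case
      by (intro lim_imp_Liminf tendsto_ennrealI) auto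
  qed
  then have "ennreal (f x) = (\<integral>\<^sup>+\<omega>. liminf (\<lambda>n. ennreal (f (\<omega> (u n)))) \<partial>P x)"
    by (subst nn_integral_cong_AE[of _ "\<lambda>_. ennreal (f x)"]) (auto simp: emeasure_space_1)
  also have "\<dots> \<le> liminf (\<lambda>n. \<integral>\<^sup>+\<omega>. ennreal (f (\<omega> (u n))) \<partial>P x)"
  proof (rule nn_integral_liminf)
    fix n
    have "0 \<le> u n" using u(2)[of n] by simp
    from measurable_borel_right_process[OF P this]
    show "(\<lambda>\<omega>. ennreal (f (\<omega> (u n)))) \<in> borel_measurable (P x)" by measurable
  qed
  finally show ?thesis by (simp add: nn_semigroup_op_def)
qed

lemma finely_continuous_continuous:
  assumes P: "borel_right_process P" and f: "continuous_on UNIV f"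
  shows "finely_continuous P f"
  unfolding finely_continuous_def
proof
  fix x
  have "AE \<omega> in P x. \<omega> \<in> cadlag_paths"
    using AE_space[of "P x"] by (simp add: borel_right_process_space[OF P])
  then show "AE \<omega> in P x. \<forall>t\<ge>0. ((\<lambda>s. f (\<omega> s)) \<longlongrightarrow> f (\<omega> t)) (at_right t)"
  proof eventually_elim
    case (elim \<omega>)
    then have "\<forall>t\<ge>0. (\<omega> \<longlongrightarrow> \<omega> t) (at_right t)" by (simp add: cadlag_paths_def)
    then show ?case
      by (intro allI impI continuous_on_tendsto_compose[OF f]) auto
  qed
qed

section \<open>Processes with transition densities\<close>

text \<open>Common abstraction of a process and its dual, the latter with the transposed density.
  The one-time laws are described by nonnegative integrals, so that unbounded functions such as psi
  can be integrated without integrability conditions.\<close>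

locale density_process = sigma_finite_measure m
  for m :: "'e::topological_space measure" +
  fixes P :: "'e \<Rightarrow> (real \<Rightarrow> 'e) measure"
    and p :: "real \<Rightarrow> 'e \<Rightarrow> 'e \<Rightarrow> real"
  assumes sets_m [measurable_cong, simp]: "sets m = sets borel"
    and right: "borel_right_process P"
    and p_measurable: "0 < t \<Longrightarrow> (\<lambda>(x, y). p t x y) \<in> borel_measurable (borel \<Otimes>\<^sub>M borel)"
    and p_pos: "0 < t \<Longrightarrow> 0 < p t x y"
    and emeasure_eval: "0 < t \<Longrightarrow> A \<in> sets borel \<Longrightarrow>
      emeasure (P x) {\<omega> \<in> cadlag_paths. \<omega> t \<in> A} = (\<integral>\<^sup>+y. ennreal (p t x y) * indicator A y \<partial>m)"
begin

lemma space_m [simp]: "space m = UNIV"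
  using sets_eq_imp_space_eq[OF sets_m] by simp

lemma measurable_m [simp]: "measurable m N = measurable borel N"
  by (rule measurable_cong_sets) auto

lemma p_measurable1 [measurable]: "0 < t \<Longrightarrow> p t x \<in> borel_measurable borel"
  using measurable_compose[OF measurable_Pair1'[of x borel borel] p_measurable[of t]] by simp

lemma p_measurable2 [measurable]: "0 < t \<Longrightarrow> (\<lambda>x. p t x y) \<in> borel_measurable borel"
  using measurable_compose[OF measurable_Pair2'[of y borel borel] p_measurable[of t]] by simp

text \<open>\<open>emeasure_eval\<close> identifies the image law of X_t with a density with respect
  to \<open>m\<close>; integrating against that law passes from sets to all positive
  functions.\<close>

lemma semigroup_density:
  assumes t: "0 < t" and [measurable]: "f \<in> borel_measurable borel"
  shows "nn_semigroup_op P t f x = (\<integral>\<^sup>+y. ennreal (p t x y) * f y \<partial>m)"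
proof -
  have [measurable]: "(\<lambda>\<omega>. \<omega> t) \<in> measurable (P x) borel"
    using t by (intro measurable_borel_right_process[OF right]) auto
  have "distr (P x) borel (\<lambda>\<omega>. \<omega> t) = density m (\<lambda>y. ennreal (p t x y))"
  proof (rule measure_eqI)
    fix A assume "A \<in> sets (distr (P x) borel (\<lambda>\<omega>. \<omega> t))"
    then have A: "A \<in> sets borel" by simp
    have "(\<lambda>\<omega>. \<omega> t) -` A \<inter> space (P x) = {\<omega> \<in> cadlag_paths. \<omega> t \<in> A}"
      by (auto simp: borel_right_process_space[OF right])
    then show "emeasure (distr (P x) borel (\<lambda>\<omega>. \<omega> t)) A = emeasure (density m (\<lambda>y. ennreal (p t x y))) A"
      using t A emeasure_eval[OF t A] by (simp add: emeasure_distr emeasure_density)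
  qed simp
  then have "(\<integral>\<^sup>+y. f y \<partial>distr (P x) borel (\<lambda>\<omega>. \<omega> t)) = (\<integral>\<^sup>+y. f y \<partial>density m (\<lambda>y. ennreal (p t x y)))"
    by simp
  then show ?thesis
    using t by (simp add: nn_integral_distr nn_integral_density nn_semigroup_op_def)
qed

lemma semigroup_measurable [measurable]:
  assumes t: "0 < t" and [measurable]: "f \<in> borel_measurable borel"
  shows "nn_semigroup_op P t f \<in> borel_measurable borel"
proof -
  note [measurable] = p_measurable[OF t]
  have "(\<lambda>x. \<integral>\<^sup>+y. ennreal (p t x y) * f y \<partial>m) \<in> borel_measurable borel"
    by measurable
  then show ?thesis
    using semigroup_density[OF t, of f] by (simp cong: measurable_cong)
qed

lemma semigroup_zero:
  "nn_semigroup_op P 0 f x = f x"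
proof -
  interpret prob_space "P x" using right by (simp add: borel_right_process_def)
  have "AE \<omega> in P x. \<omega> 0 = x" using right by (simp add: borel_right_process_def)
  then show ?thesis
    unfolding nn_semigroup_op_def
    by (subst nn_integral_cong_AE[of _ "\<lambda>_. f x"]) (auto simp: emeasure_space_1)
qed

text \<open>If \<open>U\<close> were null, then under the law from x the path would almost surely
  avoid \<open>U\<close> at all the countably many times 1/(n+1). But it starts at x in
  \<open>U\<close> and is right-continuous, so it lies in \<open>U\<close> at all small
  times.\<close>

lemma emeasure_open_pos:
  assumes "open U" "x \<in> U"
  shows "emeasure m U \<noteq> 0"
proof
  assume 0: "emeasure m U = 0"
  interpret prob_space "P x" using right by (simp add: borel_right_process_def)
  have U [measurable]: "U \<in> sets borel" using assms by simp
  have "AE y in m. y \<notin> U"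
    using 0 by (intro AE_not_in) (auto simp: null_sets_def)
  then have null: "(\<integral>\<^sup>+y. ennreal (p t x y) * indicator U y \<partial>m) = 0" if "0 < t" for t
    using that by (subst nn_integral_0_iff_AE) auto
  have "AE \<omega> in P x. \<not> \<omega> (inverse (real (Suc n))) \<in> U" for n
  proof (rule AE_I')
    let ?t = "inverse (real (Suc n))"
    have "{\<omega> \<in> cadlag_paths. \<omega> ?t \<in> U} = (\<lambda>\<omega>. \<omega> ?t) -` U \<inter> space (P x)"
      by (auto simp: borel_right_process_space[OF right])
    also have "\<dots> \<in> sets (P x)"
      by (intro measurable_sets[OF measurable_borel_right_process[OF right]]) auto
    finally show "{\<omega> \<in> cadlag_paths. \<omega> ?t \<in> U} \<in> null_sets (P x)"
      using emeasure_eval[OF _ U, of ?t x] null[of ?t] by (auto simp: null_sets_def)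
  qed (auto simp: borel_right_process_space[OF right])
  then have "AE \<omega> in P x. \<forall>n. \<not> \<omega> (inverse (real (Suc n))) \<in> U"
    by (simp add: AE_all_countable)
  moreover have "AE \<omega> in P x. \<omega> 0 = x" using right by (simp add: borel_right_process_def)
  moreover have "AE \<omega> in P x. \<omega> \<in> cadlag_paths"
    using AE_space[of "P x"] by (simp add: borel_right_process_space[OF right])
  ultimately have "AE \<omega> in P x. False"
  proof eventually_elim
    case (elim \<omega>)
    have "\<forall>t\<ge>0. (\<omega> \<longlongrightarrow> \<omega> t) (at_right t)" using elim by (simp add: cadlag_paths_def)
    then have "(\<omega> \<longlongrightarrow> x) (at_right 0)" using elim by force
    moreover have "filterlim (\<lambda>n. inverse (real (Suc n))) (at_right 0) sequentially"
      using LIMSEQ_inverse_real_of_nat by (auto simp: filterlim_at)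
    ultimately have "(\<lambda>n. \<omega> (inverse (real (Suc n)))) \<longlonglongrightarrow> x"
      by (rule filterlim_compose)
    from topological_tendstoD[OF this assms] elim show ?case
      by (auto simp: eventually_sequentially)
  qed
  then show False by simp
qed

text \<open>The set where two continuous functions differ is open, and no nonempty open set is
  null.\<close>

lemma continuous_AE_eq_imp_eq:
  fixes f g :: "'e \<Rightarrow> real"
  assumes "AE x in m. f x = g x" "continuous_on UNIV f" "continuous_on UNIV g"
  shows "f x = g x"
proof (rule ccontr)
  assume "f x \<noteq> g x"
  let ?U = "{x. f x \<noteq> g x}"
  have "open ?U" using assms(2,3) by (rule open_Collect_neq)
  moreover have "emeasure m ?U = 0"
    using emeasure_eq_0_AE[of "\<lambda>x. f x \<noteq> g x" m] assms(1) by simp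
  ultimately show False
    using emeasure_open_pos[of ?U x] \<open>f x \<noteq> g x\<close> by simp
qed

lemma two_time_law:
  assumes s: "0 < s" "s < t" and [measurable]: "A \<in> sets borel" "f \<in> borel_measurable borel"
  shows "(\<integral>\<^sup>+\<omega>. indicator A (\<omega> s) * f (\<omega> t) \<partial>P x) =
    (\<integral>\<^sup>+y. \<integral>\<^sup>+z. ennreal (p s x y) * indicator A y * (ennreal (p (t - s) y z) * f z) \<partial>m \<partial>m)"
proof -
  let ?A = "path_cylinder {s} (\<lambda>_. A)"
  have *: "AE \<omega> in P x. indicator ?A \<omega> = (indicator A (\<omega> s) :: ennreal)"
    by (rule AE_I2) (auto simp: path_cylinder_def borel_right_process_space[OF right] indicator_def)
  have "(\<integral>\<^sup>+\<omega>. indicator A (\<omega> s) * f (\<omega> t) \<partial>P x) = (\<integral>\<^sup>+\<omega>. f (\<omega> ((t - s) + s)) * indicator ?A \<omega> \<partial>P x)"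
    by (rule nn_integral_cong_AE) (use * in \<open>eventually_elim, simp add: mult.commute\<close>)
  also have "\<dots> = (\<integral>\<^sup>+\<omega>. nn_semigroup_op P (t - s) f (\<omega> s) * indicator ?A \<omega> \<partial>P x)"
    using s by (intro borel_right_process_markov[OF right]) auto
  also have "\<dots> = nn_semigroup_op P s (\<lambda>y. indicator A y * nn_semigroup_op P (t - s) f y) x"
    unfolding nn_semigroup_op_def[of P s]
    by (rule nn_integral_cong_AE) (use * in \<open>eventually_elim, simp add: mult.commute\<close>)
  also have "\<dots> = (\<integral>\<^sup>+y. ennreal (p s x y) * (indicator A y * (\<integral>\<^sup>+z. ennreal (p (t - s) y z) * f z \<partial>m)) \<partial>m)"
    using s by (subst semigroup_density) (simp_all add: semigroup_density[of "t - s", symmetric])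
  finally show ?thesis
    using s by (simp add: nn_integral_cmult[symmetric] mult.assoc)
qed

end

section \<open>From an h-transform of semigroups to an h-transform of laws on path space\<close>

text \<open>Both sides are compared on cylinders by peeling off the latest time \<open>b\<close>.
  The Markov property of \<open>Q\<close> reduces to a function of X_b, the induction hypothesis
  passes to \<open>P\<close>, the factor psi(X_b) cancels the denominator contributed by Q_u, and
  the Markov property of \<open>P\<close> is then read backwards.\<close>

lemma h_transform_law:
  fixes \<psi> :: "'e::topological_space \<Rightarrow> real"
  assumes P: "density_process m P p" and Q: "density_process m' Q q"
    and psi [measurable]: "\<psi> \<in> borel_measurable borel" and pos: "\<And>x. 0 < \<psi> x"
    and semi: "\<And>t f x. 0 < t \<Longrightarrow> f \<in> borel_measurable borel \<Longrightarrow>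
       nn_semigroup_op Q t f x = ennreal (exp (- c * t) / \<psi> x) * nn_semigroup_op P t (\<lambda>y. ennreal (\<psi> y) * f y) x"
    and t: "0 \<le> t"
  shows "restr_to_subalg (Q x) (path_sigma {0..t}) =
    density (restr_to_subalg (P x) (path_sigma {0..t}))
      (\<lambda>\<omega>. ennreal (exp (- c * t) * (\<psi> (\<omega> t) / \<psi> (\<omega> 0))))"
    (is "?L = ?R")
proof -
  interpret P: density_process m P p by fact
  interpret Q: density_process m' Q q by fact
  interpret Qx: prob_space "Q x" using Q.right by (simp add: borel_right_process_def)
  \<comment> \<open>Time 0 is added by hand, because densities exist only at positive times.\<close>
  have semi': "nn_semigroup_op Q t f x = ennreal (exp (- c * t) / \<psi> x) * nn_semigroup_op P t (\<lambda>y. ennreal (\<psi> y) * f y) x"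
    if "0 \<le> t" "f \<in> borel_measurable borel" for t f x
  proof (cases "t = 0")
    case True
    have "ennreal (1 / \<psi> x) * (ennreal (\<psi> x) * f x) = f x"
      using pos[of x] by (simp add: mult.assoc[symmetric] ennreal_mult[symmetric])
    then show ?thesis using True by (simp add: P.semigroup_zero Q.semigroup_zero)
  qed (use semi that in auto)
  \<comment> \<open>The free factor f(X_s), at a time beyond all indices, makes the induction close:
    the hypothesis is reused at the earlier time \<open>b\<close> with another function.\<close>
  have cyl: "(\<integral>\<^sup>+\<omega>. f (\<omega> s) * indicator (path_cylinder J A) \<omega> \<partial>Q x) =
     ennreal (exp (- c * s) / \<psi> x) * (\<integral>\<^sup>+\<omega>. ennreal (\<psi> (\<omega> s)) * f (\<omega> s) * indicator (path_cylinder J A) \<omega> \<partial>P x)"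
    if "finite J" and A: "\<And>j. A j \<in> sets borel" and "\<forall>j\<in>J. 0 \<le> j \<and> j \<le> s" "0 \<le> s" "f \<in> borel_measurable borel"
    for J A s f
    using that(1,3-)
  proof (induction J arbitrary: s f rule: finite_linorder_max_induct)
    case empty
    have "(\<integral>\<^sup>+\<omega>. f (\<omega> s) * indicator (path_cylinder {} A) \<omega> \<partial>Q x) = nn_semigroup_op Q s f x"
      unfolding nn_semigroup_op_def
      by (rule nn_integral_cong) (simp add: path_cylinder_def borel_right_process_space[OF Q.right])
    moreover have "(\<integral>\<^sup>+\<omega>. ennreal (\<psi> (\<omega> s)) * f (\<omega> s) * indicator (path_cylinder {} A) \<omega> \<partial>P x) =
      nn_semigroup_op P s (\<lambda>y. ennreal (\<psi> y) * f y) x"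
      unfolding nn_semigroup_op_def
      by (rule nn_integral_cong) (simp add: path_cylinder_def borel_right_process_space[OF P.right])
    ultimately show ?case using semi'[of s f] empty by simp
  next
    case (insert b J)
    note [measurable] = A \<open>f \<in> borel_measurable borel\<close>
    have ind: "indicator (path_cylinder (insert b J) A) \<omega> =
      (indicator (A b) (\<omega> b) * indicator (path_cylinder J A) \<omega> :: ennreal)" for \<omega>
      by (auto simp: path_cylinder_def indicator_def)
    have b: "0 \<le> b" "b \<le> s" and J: "\<forall>j\<in>J. 0 \<le> j \<and> j \<le> b"
      using insert by (auto simp: less_imp_le)
    \<comment> \<open>The constraint at \<open>b\<close> is moved into the function, which leaves a
      cylinder over the smaller set \<open>J\<close>.\<close>
    have at_b: "(\<integral>\<^sup>+\<omega>. g (\<omega> b) * indicator (path_cylinder (insert b J) A) \<omega> \<partial>Q x) =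
     ennreal (exp (- c * b) / \<psi> x) *
       (\<integral>\<^sup>+\<omega>. ennreal (\<psi> (\<omega> b)) * g (\<omega> b) * indicator (path_cylinder (insert b J) A) \<omega> \<partial>P x)"
      if [measurable]: "g \<in> borel_measurable borel" for g
      using insert.IH[OF J b(1), of "\<lambda>y. g y * indicator (A b) y"]
      by (simp add: ind mult.assoc)
    show ?case
    proof (cases "b = s")
      case True
      then show ?thesis using at_b[of f] by simp
    next
      case False
      define u where "u = s - b"
      have u: "0 < u" "s = u + b" using False b by (auto simp: u_def)
      have C: "path_cylinder (insert b J) A \<in> sets (path_sigma {0..b})"
        using insert b J A by (intro path_cylinder_sets) auto
      have "(\<integral>\<^sup>+\<omega>. f (\<omega> s) * indicator (path_cylinder (insert b J) A) \<omega> \<partial>Q x) =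
        (\<integral>\<^sup>+\<omega>. nn_semigroup_op Q u f (\<omega> b) * indicator (path_cylinder (insert b J) A) \<omega> \<partial>Q x)"
        unfolding u using u b C by (intro borel_right_process_markov Q.right) auto
      also have "\<dots> = ennreal (exp (- c * b) / \<psi> x) *
       (\<integral>\<^sup>+\<omega>. ennreal (\<psi> (\<omega> b)) * nn_semigroup_op Q u f (\<omega> b) * indicator (path_cylinder (insert b J) A) \<omega> \<partial>P x)"
        using u by (intro at_b) auto
      also have "(\<lambda>\<omega>. ennreal (\<psi> (\<omega> b)) * nn_semigroup_op Q u f (\<omega> b) * indicator (path_cylinder (insert b J) A) \<omega>) =
         (\<lambda>\<omega>. ennreal (exp (- c * u)) * nn_semigroup_op P u (\<lambda>y. ennreal (\<psi> y) * f y) (\<omega> b) *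
           indicator (path_cylinder (insert b J) A) \<omega>)"
      proof
        fix \<omega>
        have "ennreal (\<psi> (\<omega> b)) * ennreal (exp (- c * u) / \<psi> (\<omega> b)) = ennreal (exp (- c * u))"
          using pos[of "\<omega> b"] by (simp add: ennreal_mult[symmetric] less_imp_le)
        then show "ennreal (\<psi> (\<omega> b)) * nn_semigroup_op Q u f (\<omega> b) * indicator (path_cylinder (insert b J) A) \<omega> =
         ennreal (exp (- c * u)) * nn_semigroup_op P u (\<lambda>y. ennreal (\<psi> y) * f y) (\<omega> b) *
           indicator (path_cylinder (insert b J) A) \<omega>"
          using u by (subst semi) (simp_all add: mult.assoc[symmetric])
      qed
      also have "(\<integral>\<^sup>+\<omega>. ennreal (exp (- c * u)) * nn_semigroup_op P u (\<lambda>y. ennreal (\<psi> y) * f y) (\<omega> b) *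
           indicator (path_cylinder (insert b J) A) \<omega> \<partial>P x) =
         ennreal (exp (- c * u)) * (\<integral>\<^sup>+\<omega>. nn_semigroup_op P u (\<lambda>y. ennreal (\<psi> y) * f y) (\<omega> b) *
           indicator (path_cylinder (insert b J) A) \<omega> \<partial>P x)"
        unfolding mult.assoc
      proof (rule nn_integral_cmult)
        have [measurable]: "path_cylinder (insert b J) A \<in> sets (P x)"
          using insert b J A by (subst borel_right_process_sets[OF P.right]) (intro path_cylinder_sets, auto)
        note [measurable] = measurable_borel_right_process[OF P.right b(1)]
        show "(\<lambda>\<omega>. nn_semigroup_op P u (\<lambda>y. ennreal (\<psi> y) * f y) (\<omega> b) *
           indicator (path_cylinder (insert b J) A) \<omega>) \<in> borel_measurable (P x)"
          using u by measurable
      qed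
      also have "(\<integral>\<^sup>+\<omega>. nn_semigroup_op P u (\<lambda>y. ennreal (\<psi> y) * f y) (\<omega> b) *
           indicator (path_cylinder (insert b J) A) \<omega> \<partial>P x) =
           (\<integral>\<^sup>+\<omega>. ennreal (\<psi> (\<omega> s)) * f (\<omega> s) * indicator (path_cylinder (insert b J) A) \<omega> \<partial>P x)"
        unfolding u using u b C by (intro borel_right_process_markov[symmetric] P.right) auto
      finally have "(\<integral>\<^sup>+\<omega>. f (\<omega> s) * indicator (path_cylinder (insert b J) A) \<omega> \<partial>Q x) =
        ennreal (exp (- c * b) / \<psi> x) * ennreal (exp (- c * u)) *
        (\<integral>\<^sup>+\<omega>. ennreal (\<psi> (\<omega> s)) * f (\<omega> s) * indicator (path_cylinder (insert b J) A) \<omega> \<partial>P x)"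
        by (simp only: mult.assoc)
      moreover have "ennreal (exp (- c * b) / \<psi> x) * ennreal (exp (- c * u)) = ennreal (exp (- c * s) / \<psi> x)"
        using pos[of x] u(2) by (simp add: ennreal_mult[symmetric] less_imp_le mult_exp_exp algebra_simps)
      ultimately show ?thesis by simp
    qed
  qed
  have subP: "subalgebra (P x) (path_sigma {0..t})" and subQ: "subalgebra (Q x) (path_sigma {0..t})"
    by (auto intro!: subalgebra_path_sigma P.right Q.right)
  show ?thesis
  proof (rule path_measure_eqI)
    show "sets ?L = sets (path_sigma {0..t})" by (rule sets_restr_to_subalg[OF subQ])
    show "sets ?R = sets (path_sigma {0..t})" by (simp add: sets_restr_to_subalg[OF subP])
    show "finite_measure ?L"
      using emeasure_restr_to_subalg[OF subQ sets.top]
      by (intro finite_measureI) (simp add: space_restr_to_subalg borel_right_process_space[OF Q.right])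
    fix J :: "real set" and A :: "real \<Rightarrow> 'e set" assume J: "finite J" "J \<subseteq> {0..t}" and A: "\<And>j. A j \<in> sets borel"
    let ?C = "path_cylinder J A"
    let ?d = "\<lambda>\<omega>. ennreal (exp (- c * t) * (\<psi> (\<omega> t) / \<psi> (\<omega> 0)))"
    have [measurable]: "?C \<in> sets (path_sigma {0..t})" using J A by (rule path_cylinder_sets)
    have [measurable]: "(\<lambda>\<omega>. \<omega> t) \<in> measurable (path_sigma {0..t}) borel" "(\<lambda>\<omega>. \<omega> 0) \<in> measurable (path_sigma {0..t}) borel"
      using t by (auto intro!: measurable_path_eval)
    have d [measurable]: "?d \<in> borel_measurable (path_sigma {0..t})" by measurable
    have "emeasure ?L ?C = emeasure (Q x) ?C" by (rule emeasure_restr_to_subalg[OF subQ]) simp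
    also have "\<dots> = (\<integral>\<^sup>+\<omega>. 1 * indicator ?C \<omega> \<partial>Q x)"
    proof -
      have "?C \<in> sets (Q x)" using subQ \<open>?C \<in> sets (path_sigma {0..t})\<close> by (auto simp: subalgebra_def)
      then show ?thesis by simp
    qed
    also have "\<dots> = ennreal (exp (- c * t) / \<psi> x) * (\<integral>\<^sup>+\<omega>. ennreal (\<psi> (\<omega> t)) * 1 * indicator ?C \<omega> \<partial>P x)"
      using J t A by (intro cyl[of J A t "\<lambda>_. 1"]) auto
    also have "\<dots> = (\<integral>\<^sup>+\<omega>. ennreal (exp (- c * t) / \<psi> x) * (ennreal (\<psi> (\<omega> t)) * 1 * indicator ?C \<omega>) \<partial>P x)"
      by (intro nn_integral_cmult[symmetric] measurable_from_subalg[OF subP]) measurable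
    also have "\<dots> = (\<integral>\<^sup>+\<omega>. ?d \<omega> * indicator ?C \<omega> \<partial>P x)"
    \<comment> \<open>Paths start at x almost surely, so the constant psi(x) may be written as
      psi(X_0).\<close>
    proof (rule nn_integral_cong_AE)
      have "AE \<omega> in P x. \<omega> 0 = x" using P.right by (simp add: borel_right_process_def)
      then show "AE \<omega> in P x. ennreal (exp (- c * t) / \<psi> x) * (ennreal (\<psi> (\<omega> t)) * 1 * indicator ?C \<omega>) = ?d \<omega> * indicator ?C \<omega>"
        by eventually_elim (use pos in \<open>simp add: mult.assoc[symmetric] ennreal_mult[symmetric] less_imp_le\<close>)
    qed
    also have "\<dots> = (\<integral>\<^sup>+\<omega>. ?d \<omega> * indicator ?C \<omega> \<partial>restr_to_subalg (P x) (path_sigma {0..t}))"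
      by (rule nn_integral_subalgebra2[OF subP, symmetric]) measurable
    also have "\<dots> = emeasure ?R ?C"
      by (intro emeasure_density[symmetric] measurable_in_subalg[OF subP] d) (simp add: sets_restr_to_subalg[OF subP])
    finally show "emeasure ?L ?C = emeasure ?R ?C" .
  qed
qed

section \<open>The process and its dual as instances of the locale\<close>

text \<open>Translates hypothesis (T), stated with Bochner integrals of bounded functions, into
  nonnegative integrals of indicators.\<close>

lemma density_processI:
  fixes m :: "'e::topological_space measure"
  assumes m: "sets m = sets borel" "sigma_finite_measure m" and P: "borel_right_process P"
    and meas: "\<And>t. 0 < t \<Longrightarrow> (\<lambda>(x, y). p t x y) \<in> borel_measurable (borel \<Otimes>\<^sub>M borel)"
    and pos: "\<And>t x y. 0 < t \<Longrightarrow> 0 < p t x y"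
    and semi: "\<And>t x f. 0 < t \<Longrightarrow> f \<in> borel_measurable borel \<Longrightarrow> bounded (range f) \<Longrightarrow>
      semigroup_op P t f x = (\<integral>y. p t x y * f y \<partial>m)"
  shows "density_process m P p"
proof -
  interpret sigma_finite_measure m by fact
  show ?thesis
  proof
    fix t :: real and A :: "'e set" and x assume t: "0 < t" and A: "A \<in> sets borel"
    interpret Px: prob_space "P x" using P by (simp add: borel_right_process_def)
    have bdd: "bounded (range (indicator C :: 'e \<Rightarrow> real))" for C
      by (rule boundedI[of _ 1]) (auto simp: indicator_def)
    have mm: "measurable m borel = measurable borel (borel :: real measure)"
      by (rule measurable_cong_sets) (auto simp: m)
    have [measurable]: "p t x \<in> borel_measurable m"
      unfolding mm using measurable_compose[OF measurable_Pair1'[of x borel borel] meas[OF t]] by simp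
    have [measurable]: "A \<in> sets m" using A m by simp
    have "semigroup_op P t (indicator UNIV) x = 1"
      by (simp add: semigroup_op_def Px.prob_space)
    then have "(\<integral>y. p t x y \<partial>m) = 1"
      using semi[OF t _ bdd[of UNIV], of x] by simp
    \<comment> \<open>A function that is not integrable has Bochner integral 0 by default, so total
      mass 1 forces integrability.\<close>
    then have "integrable m (p t x)"
      using not_integrable_integral_eq[of m "p t x"] by force
    then have int: "integrable m (\<lambda>y. p t x y * indicator A y)"
      by (rule integrable_real_mult_indicator[rotated]) fact
    have "{\<omega> \<in> cadlag_paths. \<omega> t \<in> A} = (\<lambda>\<omega>. \<omega> t) -` A \<inter> space (P x)"
      by (auto simp: borel_right_process_space[OF P])
    then have ev: "{\<omega> \<in> cadlag_paths. \<omega> t \<in> A} \<in> sets (P x)"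
      using t A by (auto intro!: measurable_sets[OF measurable_borel_right_process[OF P]])
    have "emeasure (P x) {\<omega> \<in> cadlag_paths. \<omega> t \<in> A} = ennreal (\<integral>\<omega>. indicator {\<omega> \<in> cadlag_paths. \<omega> t \<in> A} \<omega> \<partial>P x)"
      using ev by (simp add: Px.emeasure_eq_measure)
    also have "(\<integral>\<omega>. indicator {\<omega> \<in> cadlag_paths. \<omega> t \<in> A} \<omega> \<partial>P x) = semigroup_op P t (indicator A) x"
      unfolding semigroup_op_def
      by (rule Bochner_Integration.integral_cong) (auto simp: borel_right_process_space[OF P] indicator_def)
    also have "\<dots> = (\<integral>y. p t x y * indicator A y \<partial>m)"
      using A by (intro semi t bdd) auto
    also have "ennreal \<dots> = (\<integral>\<^sup>+y. ennreal (p t x y * indicator A y) \<partial>m)"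
      using pos[OF t] by (intro nn_integral_eq_integral[symmetric] int) (auto simp: less_imp_le)
    finally show "emeasure (P x) {\<omega> \<in> cadlag_paths. \<omega> t \<in> A} = (\<integral>\<^sup>+y. ennreal (p t x y) * indicator A y \<partial>m)"
      by (simp add: indicator_mult_ennreal mult.commute)
  qed (use assms in auto)
qed

lemma transition_density_measurable:
  assumes "transition_density_hyp P P' m p" "0 < t"
  shows "(\<lambda>(x, y). p t x y) \<in> borel_measurable (borel \<Otimes>\<^sub>M borel)"
proof -
  have 1: "(\<lambda>(x, t, y). p t x y) \<in> borel_measurable (borel \<Otimes>\<^sub>M (restrict_space borel {0<..} \<Otimes>\<^sub>M borel))"
    using assms by (simp add: transition_density_hyp_def)
  have 2: "(\<lambda>z. (fst z, t, snd z)) \<in> measurable (borel \<Otimes>\<^sub>M borel) (borel \<Otimes>\<^sub>M (restrict_space borel {0<..} \<Otimes>\<^sub>M borel))"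
    using assms(2) by (auto intro!: measurable_Pair simp: space_restrict_space)
  from measurable_compose[OF 2 1] show ?thesis
    by (simp add: case_prod_beta')
qed

lemma density_process_primal:
  assumes "borel_right_process P" "duality_hyp P P' m" "transition_density_hyp P P' m p"
  shows "density_process m P p"
  using assms transition_density_measurable[OF assms(3)]
  by (intro density_processI) (auto simp: duality_hyp_def transition_density_hyp_def)

lemma density_process_dual:
  assumes "duality_hyp P P' m" "transition_density_hyp P P' m p"
  shows "density_process m P' (\<lambda>t x y. p t y x)"
proof (rule density_processI)
  fix t :: real assume "0 < t"
  from measurable_pair_swap[OF transition_density_measurable[OF assms(2) this]]
  show "(\<lambda>(x, y). p t y x) \<in> borel_measurable (borel \<Otimes>\<^sub>M borel)" by (simp add: case_prod_beta)
qed (use assms in \<open>auto simp: duality_hyp_def transition_density_hyp_def\<close>)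

section \<open>Identifying densities from one-time and two-time marginals\<close>

text \<open>Two passes replace joint continuity: for almost every x the rows agree everywhere, hence
  for every y the columns agree almost everywhere, and so everywhere.\<close>

lemma (in density_process) separately_continuous_AE_eq_imp_eq:
  fixes f g :: "'e \<Rightarrow> 'e \<Rightarrow> real"
  assumes "AE x in m. AE y in m. f x y = g x y"
    and "\<And>x. continuous_on UNIV (f x)" "\<And>x. continuous_on UNIV (g x)"
    and "\<And>y. continuous_on UNIV (\<lambda>x. f x y)" "\<And>y. continuous_on UNIV (\<lambda>x. g x y)"
  shows "f x y = g x y"
proof -
  have "AE x in m. f x y = g x y" for y
    using assms(1) by eventually_elim (rule continuous_AE_eq_imp_eq[OF _ assms(2,3)])
  from continuous_AE_eq_imp_eq[OF this assms(4,5)] show ?thesis .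
qed

text \<open>The two functions are densities of measures on the product that agree on rectangles and
  have finite mass, hence of the same measure; uniqueness of densities and Fubini conclude.\<close>

lemma AE_eq_if_rectangle_integrals_eq:
  fixes f g :: "'a \<times> 'a \<Rightarrow> ennreal"
  assumes "sigma_finite_measure M"
    and f [measurable]: "f \<in> borel_measurable (M \<Otimes>\<^sub>M M)" and g [measurable]: "g \<in> borel_measurable (M \<Otimes>\<^sub>M M)"
    and eq: "\<And>A B. A \<in> sets M \<Longrightarrow> B \<in> sets M \<Longrightarrow>
      (\<integral>\<^sup>+x. \<integral>\<^sup>+y. f (x, y) * (indicator A x * indicator B y) \<partial>M \<partial>M) =
      (\<integral>\<^sup>+x. \<integral>\<^sup>+y. g (x, y) * (indicator A x * indicator B y) \<partial>M \<partial>M)"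
    and fin: "(\<integral>\<^sup>+x. \<integral>\<^sup>+y. f (x, y) \<partial>M \<partial>M) < \<infinity>"
  shows "AE x in M. AE y in M. f (x, y) = g (x, y)"
proof -
  interpret M: sigma_finite_measure M by fact
  interpret pair_sigma_finite M M ..
  have rect: "emeasure (density (M \<Otimes>\<^sub>M M) k) (A \<times> B) =
      (\<integral>\<^sup>+x. \<integral>\<^sup>+y. k (x, y) * (indicator A x * indicator B y) \<partial>M \<partial>M)"
    if [measurable]: "k \<in> borel_measurable (M \<Otimes>\<^sub>M M)" "A \<in> sets M" "B \<in> sets M" for k A B
    by (simp add: emeasure_density M.nn_integral_fst[symmetric] indicator_times)
  have "density (M \<Otimes>\<^sub>M M) f = density (M \<Otimes>\<^sub>M M) g"
  proof (rule measure_eqI_generator_eq[where E = "{a \<times> b | a b. a \<in> sets M \<and> b \<in> sets M}"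
        and \<Omega> = "space M \<times> space M" and A = "\<lambda>_. space M \<times> space M"])
    show "Int_stable {a \<times> b |a b. a \<in> sets M \<and> b \<in> sets M}"
      by (rule Int_stable_pair_measure_generator)
    show "emeasure (density (M \<Otimes>\<^sub>M M) f) X = emeasure (density (M \<Otimes>\<^sub>M M) g) X"
      if "X \<in> {a \<times> b |a b. a \<in> sets M \<and> b \<in> sets M}" for X
      using that eq by (auto simp: rect)
    have "(\<integral>\<^sup>+x. \<integral>\<^sup>+y. f (x, y) * (indicator (space M) x * indicator (space M) y) \<partial>M \<partial>M) = (\<integral>\<^sup>+x. \<integral>\<^sup>+y. f (x, y) \<partial>M \<partial>M)"
      by (intro nn_integral_cong) simp
    then show "emeasure (density (M \<Otimes>\<^sub>M M) f) (space M \<times> space M) \<noteq> \<infinity>"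
      using fin by (simp add: rect)
  qed (use sets.sets_into_space in \<open>auto simp: sets_pair_measure\<close>)
  then have "AE z in M \<Otimes>\<^sub>M M. f z = g z"
    by (rule P.density_unique[OF f g])
  then show ?thesis by (rule AE_pair)
qed

lemma is_bridge_lawD:
  assumes "is_bridge_law P p x t y B" "0 \<le> s" "s < t" "F \<in> borel_measurable (path_sigma {0..s})"
  shows "(\<integral>\<^sup>+\<omega>. F \<omega> \<partial>B) = (\<integral>\<^sup>+\<omega>. F \<omega> * ennreal (p (t - s) (\<omega> s) y / p t x y) \<partial>P x)"
  using assms unfolding is_bridge_law_def by blast

context density_process
begin

lemma bridge_one_time:
  assumes B: "is_bridge_law P p x t y B" and s: "0 < s" "s < t" and [measurable]: "A \<in> sets borel"
  shows "(\<integral>\<^sup>+\<omega>. indicator A (\<omega> s) \<partial>B) =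
    (\<integral>\<^sup>+z. ennreal (p s x z * p (t - s) z y / p t x y) * indicator A z \<partial>m)"
proof -
  have [measurable]: "(\<lambda>\<omega>. \<omega> s) \<in> measurable (path_sigma {0..s}) borel"
    using s by (intro measurable_path_eval) auto
  have "(\<integral>\<^sup>+\<omega>. indicator A (\<omega> s) \<partial>B) =
      (\<integral>\<^sup>+\<omega>. indicator A (\<omega> s) * ennreal (p (t - s) (\<omega> s) y / p t x y) \<partial>P x)"
    using s by (intro is_bridge_lawD[OF B]) (auto, measurable)
  also have "\<dots> = nn_semigroup_op P s (\<lambda>z. indicator A z * ennreal (p (t - s) z y / p t x y)) x"
    by (simp add: nn_semigroup_op_def)
  also have "\<dots> = (\<integral>\<^sup>+z. ennreal (p s x z) * (indicator A z * ennreal (p (t - s) z y / p t x y)) \<partial>m)"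
    using s by (intro semigroup_density) measurable
  also have "\<dots> = (\<integral>\<^sup>+z. ennreal (p s x z * p (t - s) z y / p t x y) * indicator A z \<partial>m)"
    using s p_pos by (intro nn_integral_cong) (auto simp: indicator_def ennreal_mult[symmetric] less_imp_le)
  finally show ?thesis .
qed

text \<open>The bridge relation is used at the later time \<open>u\<close>: its weight is then a
  function of X_u, and the two-time law of \<open>P\<close> applies.\<close>

lemma bridge_two_time:
  assumes B: "is_bridge_law P p x t y B" and s: "0 < s" "s < u" "u < t"
    and [measurable]: "A \<in> sets borel" "C \<in> sets borel"
  shows "(\<integral>\<^sup>+\<omega>. indicator A (\<omega> s) * indicator C (\<omega> u) \<partial>B) =
    (\<integral>\<^sup>+z. \<integral>\<^sup>+w. ennreal (p s x z * p (u - s) z w * p (t - u) w y / p t x y) *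
       (indicator A z * indicator C w) \<partial>m \<partial>m)"
proof -
  have [measurable]: "(\<lambda>\<omega>. \<omega> s) \<in> measurable (path_sigma {0..u}) borel"
    "(\<lambda>\<omega>. \<omega> u) \<in> measurable (path_sigma {0..u}) borel"
    using s by (auto intro!: measurable_path_eval)
  have "(\<integral>\<^sup>+\<omega>. indicator A (\<omega> s) * indicator C (\<omega> u) \<partial>B) =
      (\<integral>\<^sup>+\<omega>. indicator A (\<omega> s) * indicator C (\<omega> u) * ennreal (p (t - u) (\<omega> u) y / p t x y) \<partial>P x)"
    using s by (intro is_bridge_lawD[OF B]) (auto, measurable)
  also have "\<dots> = (\<integral>\<^sup>+\<omega>. indicator A (\<omega> s) * (indicator C (\<omega> u) * ennreal (p (t - u) (\<omega> u) y / p t x y)) \<partial>P x)"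
    by (simp add: mult.assoc)
  also have "\<dots> = (\<integral>\<^sup>+z. \<integral>\<^sup>+w. ennreal (p s x z) * indicator A z *
      (ennreal (p (u - s) z w) * (indicator C w * ennreal (p (t - u) w y / p t x y))) \<partial>m \<partial>m)"
    using s by (intro two_time_law) measurable
  also have "\<dots> = (\<integral>\<^sup>+z. \<integral>\<^sup>+w. ennreal (p s x z * p (u - s) z w * p (t - u) w y / p t x y) *
       (indicator A z * indicator C w) \<partial>m \<partial>m)"
    using s p_pos by (intro nn_integral_cong) (auto simp: indicator_def ennreal_mult[symmetric] less_imp_le mult.assoc)
  finally show ?thesis .
qed

end

section \<open>From the bridge identity to an h-transform\<close>

text \<open>Pure algebra on the ratios r = q/p. Once r_s(x0,.) is known to be a scalar B(s) times a
  fixed function b, the relation \<open>key\<close> determines r_u(x,y) from b, h and the quotient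
  B(s+u)/B(s), which does not depend on s.\<close>

lemma kernel_ratio_factorization:
  fixes p q :: "real \<Rightarrow> 'e \<Rightarrow> 'e \<Rightarrow> real" and h :: "'e \<Rightarrow> real"
  assumes t0: "0 < t0" and p: "\<And>t x y. 0 < t \<Longrightarrow> 0 < p t x y" and q: "\<And>t x y. 0 < t \<Longrightarrow> 0 < q t x y"
    and h: "\<And>x. 0 < h x"
    and one: "\<And>s x. 0 < s \<Longrightarrow> s < t0 \<Longrightarrow>
      p s x0 x * p (t0 - s) x y0 / p t0 x0 y0 = h x * (q s x0 x * q (t0 - s) x y0 / q t0 x0 y0)"
    and two: "\<And>s u x y. 0 < s \<Longrightarrow> s < u \<Longrightarrow> u < t0 \<Longrightarrow>
      p s x0 x * p (u - s) x y * p (t0 - u) y y0 / p t0 x0 y0 =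
      h x * h y * (q s x0 x * q (u - s) x y * q (t0 - u) y y0 / q t0 x0 y0)"
  defines "\<psi> \<equiv> \<lambda>x. h x * (q (t0/2) x0 x / p (t0/2) x0 x)"
  obtains g where "\<And>u. 0 < u \<Longrightarrow> u < t0 \<Longrightarrow> 0 < g u"
    and "\<And>u v. 0 < u \<Longrightarrow> 0 < v \<Longrightarrow> u + v < t0 \<Longrightarrow> g (u + v) = g u * g v"
    and "\<And>u x y. 0 < u \<Longrightarrow> u < t0 \<Longrightarrow> q u x y * h y * \<psi> x = g u * \<psi> y * p u x y"
proof -
  define r where "r u x y = q u x y / p u x y" for u x y
  define b where "b = r (t0/2) x0"
  have r: "0 < r u x y" if "0 < u" for u x y
    using that p q by (simp add: r_def)
  have b: "0 < b x" for x using t0 r by (simp add: b_def)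
  \<comment> \<open>Cross-multiply hypothesis \<open>one\<close> at s+u with hypothesis
    \<open>two\<close> at s and s+u.\<close>
  have key: "r (s + u) x0 y = r s x0 x * h x * r u x y" if "0 < s" "0 < u" "s + u < t0" for s u x y
  proof -
    have "0 < t0 - (s + u)" using that by simp
    note pos = p[OF that(1), of x0 x] q[OF that(1), of x0 x] p[OF that(2), of x y] q[OF that(2), of x y]
      p[OF this, of y y0] q[OF this, of y y0] p[OF t0, of x0 y0] q[OF t0, of x0 y0] h[of x] h[of y]
      p[of "s + u" x0 y] q[of "s + u" x0 y]
    have 1: "p (s + u) x0 y * p (t0 - (s + u)) y y0 / p t0 x0 y0 =
      h y * (q (s + u) x0 y * q (t0 - (s + u)) y y0 / q t0 x0 y0)"
      using that by (intro one) auto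
    have 2: "p s x0 x * p u x y * p (t0 - (s + u)) y y0 / p t0 x0 y0 =
      h x * h y * (q s x0 x * q u x y * q (t0 - (s + u)) y y0 / q t0 x0 y0)"
      using two[of s "s + u" x y] that by simp
    \<comment> \<open>These collect the factors involving \<open>y0\<close>. They are the same in
      both identities and cancel from the cross product.\<close>
    define a c where "a = p (t0 - (s + u)) y y0 / p t0 x0 y0" and "c = h y * q (t0 - (s + u)) y y0 / q t0 x0 y0"
    have ac: "0 < a" "0 < c" using pos that by (auto simp: a_def c_def)
    have "p (s + u) x0 y * a = q (s + u) x0 y * c" "p s x0 x * p u x y * a = h x * q s x0 x * q u x y * c"
      using 1 2 by (simp_all add: a_def c_def ac_simps)
    then have "(p (s + u) x0 y * a) * (h x * q s x0 x * q u x y * c) = (q (s + u) x0 y * c) * (p s x0 x * p u x y * a)"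
      by simp
    then have "p (s + u) x0 y * (h x * q s x0 x * q u x y) = q (s + u) x0 y * (p s x0 x * p u x y)"
      using ac by (simp add: ac_simps)
    then show ?thesis
      using pos that by (simp add: r_def field_simps)
  qed
  \<comment> \<open>By \<open>key\<close> at the target \<open>x0\<close>, \<open>r s x0 x / b x\<close> does not depend on \<open>x\<close>.\<close>
  define B where "B s = (let v = (t0 - max s (t0/2)) / 2 in r (s + v) x0 x0 / r (t0/2 + v) x0 x0)" for s
  have Bpos: "0 < B s" if "0 < s" "s < t0" for s
  proof -
    define v where "v = (t0 - max s (t0/2)) / 2"
    have "0 < s + v" "0 < t0/2 + v" using that t0 by (auto simp: v_def max_def field_simps)
    then show ?thesis using r by (simp add: B_def v_def[symmetric])
  qed
  have sep: "r s x0 x = B s * b x" if "0 < s" "s < t0" for s x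
  proof -
    \<comment> \<open>Half of the room left below \<open>t0\<close> by the larger of s and t0/2, so
      that \<open>key\<close> applies with \<open>v\<close> added to either time. The unknown factor
      h(x) r_v(x,x0) is common to both instances and drops out.\<close>
    define v where "v = (t0 - max s (t0/2)) / 2"
    have v: "0 < v" "s + v < t0" "t0/2 + v < t0" using that t0 by (auto simp: v_def max_def field_simps)
    have "r (s + v) x0 x0 = r s x0 x * h x * r v x x0" using that v by (intro key) auto
    moreover have "r (t0/2 + v) x0 x0 = b x * h x * r v x x0" unfolding b_def using t0 v by (intro key) auto
    ultimately show ?thesis
      using h[of x] r[OF v(1), of x x0] b[of x] by (simp add: B_def v_def[symmetric])
  qed
  \<comment> \<open>This is B(s+u)/B(s), as \<open>shift\<close> shows at x = y = x0; being
    independent of s, it is multiplicative in u.\<close>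
  define g where "g u = r u x0 x0 * h x0" for u
  have shift: "B (s + u) * b y = B s * b x * h x * r u x y" if "0 < s" "0 < u" "s + u < t0" for s u x y
    using key[of s u y x] sep[of "s + u" y] sep[of s x] that by simp
  have Bg: "B (s + u) = B s * g u" if "0 < s" "0 < u" "s + u < t0" for s u
  proof -
    have "B (s + u) * b x0 = B s * g u * b x0" using shift[OF that, of x0 x0] by (simp add: g_def ac_simps)
    then show ?thesis using b[of x0] by simp
  qed
  show ?thesis
  proof (rule that[of g])
    show "0 < g u" if "0 < u" for u using r[OF that] h by (simp add: g_def)
    show "g (u + v) = g u * g v" if "0 < u" "0 < v" "u + v < t0" for u v
    proof -
      \<comment> \<open>An auxiliary starting time that keeps the total below \<open>t0\<close>; it
        disappears on division by \<open>B s\<close>.\<close>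
      define s where "s = (t0 - (u + v)) / 2"
      have s: "0 < s" "s + (u + v) < t0" using that by (auto simp: s_def field_simps)
      have "B s * g (u + v) = B (s + u + v)" using s that by (subst Bg[symmetric]) (auto simp: add.assoc)
      also have "\<dots> = B s * g u * g v" using s that by (subst Bg, simp, simp, simp, subst Bg) auto
      finally show ?thesis using Bpos[of s] s that by simp
    qed
    fix u x y assume u: "0 < u" "u < t0"
    define s where "s = (t0 - u) / 2"
    have s: "0 < s" "s + u < t0" using u by (auto simp: s_def field_simps)
    have "B s * (g u * b y) = B s * (b x * h x * r u x y)"
      using shift[OF s(1) u(1) s(2), of y x] Bg[OF s(1) u(1) s(2)] by (simp add: ac_simps)
    then have "g u * b y = b x * h x * r u x y" using Bpos[of s] s u by simp
    then have "g u * b y * p u x y = b x * h x * q u x y"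
      using p[OF u(1), of x y] by (simp add: r_def)
    then have "h y * (g u * b y * p u x y) = h y * (b x * h x * q u x y)" by simp
    moreover have "\<psi> z = h z * b z" for z by (simp add: \<psi>_def b_def r_def)
    ultimately show "q u x y * h y * \<psi> x = g u * \<psi> y * p u x y"
      by (auto simp: ac_simps)
  qed
qed

section \<open>A Cauchy equation on a bounded interval, with a one-sided bound at zero\<close>

text \<open>Subtract the linear function that agrees with \<open>f\<close> at a/2. The difference
  \<open>k\<close> vanishes at every fraction (a/2)/(N+1), so it has these as periods and inherits
  everywhere its asymptotic lower bound near 0. Thus \<open>k\<close> is nonnegative, while k(u) +
  k(a/2 - u) = 0.\<close>

lemma locally_additive_imp_linear:
  fixes f :: "real \<Rightarrow> real"
  assumes a: "0 < a"
    and add: "\<And>u v. 0 < u \<Longrightarrow> 0 < v \<Longrightarrow> u + v < a \<Longrightarrow> f (u + v) = f u + f v"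
    and lower: "\<And>\<epsilon>. 0 < \<epsilon> \<Longrightarrow> eventually (\<lambda>u. - \<epsilon> \<le> f u) (at_right 0)"
  obtains c where "\<And>u. 0 < u \<Longrightarrow> u < a / 2 \<Longrightarrow> f u = c * u"
proof -
  \<comment> \<open>The point a/2 is used because additivity is assumed only below \<open>a\<close>,
    where \<open>a\<close> itself is excluded.\<close>
  define c where "c = f (a/2) / (a/2)"
  define k where "k u = f u - c * u" for u
  have k_add: "k (u + v) = k u + k v" if "0 < u" "0 < v" "u + v < a" for u v
    using add[OF that] by (simp add: k_def algebra_simps)
  have k_half: "k (a/2) = 0" using a by (simp add: k_def c_def)
  \<comment> \<open>Multiples start at one: nothing is known about \<open>k\<close> at 0.\<close>
  have k_mult: "k (real (Suc n) * u) = real (Suc n) * k u" if "0 < u" "real (Suc n) * u < a" for n u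
    using that
  proof (induction n)
    case (Suc n)
    have "k (real (Suc n) * u + u) = k (real (Suc n) * u) + k u"
      using Suc.prems by (intro k_add mult_pos_pos) (auto simp: algebra_simps)
    then show ?case using Suc by (simp add: algebra_simps)
  qed simp
  have k_lower: "- \<epsilon> \<le> k u" if \<epsilon>: "0 < \<epsilon>" and u: "0 < u" "u < a" for \<epsilon> u
  proof -
    have "eventually (\<lambda>u. - (\<epsilon>/2) \<le> f u) (at_right 0)" using \<epsilon> by (intro lower) auto
    moreover have "((\<lambda>u. c * u) \<longlongrightarrow> c * 0) (at_right 0)" by (intro tendsto_intros)
    then have "eventually (\<lambda>u. c * u < \<epsilon>/2) (at_right 0)" using \<epsilon> by (intro order_tendstoD(2)) auto
    ultimately have "eventually (\<lambda>u. - \<epsilon> \<le> k u) (at_right 0)"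
      by eventually_elim (simp add: k_def)
    then obtain \<delta> where \<delta>: "0 < \<delta>" "\<And>u. 0 < u \<Longrightarrow> u < \<delta> \<Longrightarrow> - \<epsilon> \<le> k u"
      using eventually_at_right[of 0 1 "\<lambda>u. - \<epsilon> \<le> k u"] by auto
    obtain N where N: "a / 2 / real (Suc N) < \<delta>"
      using reals_Archimedean[of "\<delta> / (a/2)"] \<delta>(1) a by (auto simp: field_simps)
    \<comment> \<open>A period shorter than \<delta>: N+1 copies of \<open>d\<close> make a/2, where
      \<open>k\<close> vanishes.\<close>
    define d where "d = a / 2 / real (Suc N)"
    have d: "0 < d" "d < \<delta>" "real (Suc N) * d = a / 2" using a N by (auto simp: d_def field_simps)
    have "k (real (Suc N) * d) = real (Suc N) * k d" by (rule k_mult) (use d a in simp_all)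
    then have kd: "k d = 0" using k_half unfolding d(3) by simp
    \<comment> \<open>The ceiling minus one, not the floor, puts the remainder \<open>w\<close> in
      (0,d] and so keeps it off 0.\<close>
    define j where "j = nat (\<lceil>u / d\<rceil> - 1)"
    define w where "w = u - real j * d"
    have "0 < \<lceil>u / d\<rceil>" using u d by simp
    then have "real j = of_int \<lceil>u / d\<rceil> - 1" by (simp add: j_def)
    then have "real j < u / d" "u / d \<le> real j + 1" by linarith+
    then have w: "0 < w" "w \<le> d" using d by (auto simp: w_def field_simps)
    \<comment> \<open>Since \<open>k d = 0\<close>, \<open>k\<close> is \<open>d\<close>-periodic, so it suffices to look near 0.\<close>
    have "k u = k w"
    proof (cases j)
      case 0
      then show ?thesis by (simp add: w_def)
    next
      case (Suc i)
      have uw: "u = real j * d + w" by (simp add: w_def)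
      have "0 < real j * d" using Suc d by simp
      then have "k u = k (real j * d) + k w" using u w uw k_add by metis
      also have "k (real j * d) = 0"
        using k_mult[of d i] Suc kd d w u uw by auto
      finally show ?thesis by simp
    qed
    then show ?thesis using \<delta>(2)[of w] w d by simp
  qed
  have k_nonneg: "0 \<le> k u" if "0 < u" "u < a" for u
  proof (rule field_le_epsilon)
    fix \<epsilon> :: real assume "0 < \<epsilon>"
    from k_lower[OF this that] show "0 \<le> k u + \<epsilon>" by simp
  qed
  show ?thesis
  proof (rule that[of c])
    fix u assume u: "0 < u" "u < a / 2"
    have "k (u + (a/2 - u)) = k u + k (a/2 - u)" using u by (intro k_add) auto
    then have "k u = - k (a/2 - u)" using k_half by simp
    moreover have "0 \<le> k u" "0 \<le> k (a/2 - u)" using u by (auto intro!: k_nonneg)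
    ultimately show "f u = c * u" by (simp add: k_def)
  qed
qed

section \<open>Consequences of the kernel identity for semigroups and bridges\<close>

text \<open>The first claim integrates the kernel identity against \<open>m'\<close>, whose density
  \<open>h\<close> supplies the missing factor. The second is the case f = 1, since \<open>Q\<close>
  is conservative. The scalar \<open>k\<close> is left free so that this applies both to g(u),
  before its form is known, and to the exponential.\<close>

lemma semigroup_op_h_transform:
  assumes P: "density_process m P p" and Q: "density_process m' Q q"
    and h [measurable]: "h \<in> borel_measurable borel" and hpos: "\<And>x. 0 < h x"
    and m': "m' = density m (\<lambda>x. ennreal (h x))"
    and \<psi> [measurable]: "\<psi> \<in> borel_measurable borel" and pos: "\<And>x. 0 < \<psi> x"
    and t: "0 < t" and k: "0 < k"
    and ker: "\<And>x y. q t x y * h y * \<psi> x = k * \<psi> y * p t x y"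
  shows "f \<in> borel_measurable borel \<Longrightarrow>
      nn_semigroup_op Q t f x = ennreal (k / \<psi> x) * nn_semigroup_op P t (\<lambda>y. ennreal (\<psi> y) * f y) x"
    and "nn_semigroup_op P t (\<lambda>y. ennreal (\<psi> y)) x = ennreal (\<psi> x / k)"
proof -
  interpret P: density_process m P p by fact
  interpret Q: density_process m' Q q by fact
  interpret Qx: prob_space "Q x" using Q.right by (simp add: borel_right_process_def)
  note [measurable] = P.p_measurable1[OF t] Q.p_measurable1[OF t]
  have *: "nn_semigroup_op Q t f x = ennreal (k / \<psi> x) * nn_semigroup_op P t (\<lambda>y. ennreal (\<psi> y) * f y) x"
    if [measurable]: "f \<in> borel_measurable borel" for f
  proof -
    have "nn_semigroup_op Q t f x = (\<integral>\<^sup>+y. ennreal (q t x y) * f y \<partial>m')"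
      using t by (intro Q.semigroup_density) auto
    also have "\<dots> = (\<integral>\<^sup>+y. ennreal (h y) * (ennreal (q t x y) * f y) \<partial>m)"
      unfolding m' by (rule nn_integral_density) (simp_all, measurable)
    also have "\<dots> = (\<integral>\<^sup>+y. ennreal (k / \<psi> x) * (ennreal (p t x y) * (ennreal (\<psi> y) * f y)) \<partial>m)"
    proof (rule nn_integral_cong)
      fix y
      have "h y * q t x y = k / \<psi> x * p t x y * \<psi> y"
        using ker[of x y] pos[of x] by (simp add: field_simps)
      moreover have "0 < k / \<psi> x" using k pos[of x] by simp
      ultimately have "ennreal (h y) * ennreal (q t x y) = ennreal (k / \<psi> x) * ennreal (p t x y) * ennreal (\<psi> y)"
        using hpos[of y] pos[of y] P.p_pos[OF t, of x y] Q.p_pos[OF t, of x y]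
        by (simp only: ennreal_mult[symmetric] less_imp_le mult_pos_pos)
      then show "ennreal (h y) * (ennreal (q t x y) * f y) =
          ennreal (k / \<psi> x) * (ennreal (p t x y) * (ennreal (\<psi> y) * f y))"
        by (simp only: mult.assoc[symmetric])
    qed
    also have "\<dots> = ennreal (k / \<psi> x) * nn_semigroup_op P t (\<lambda>y. ennreal (\<psi> y) * f y) x"
      using t by (subst P.semigroup_density) (auto intro!: nn_integral_cmult)
    finally show ?thesis .
  qed
  then show "f \<in> borel_measurable borel \<Longrightarrow>
      nn_semigroup_op Q t f x = ennreal (k / \<psi> x) * nn_semigroup_op P t (\<lambda>y. ennreal (\<psi> y) * f y) x" .
  have "nn_semigroup_op Q t (\<lambda>_. 1) x = 1"
    by (simp add: nn_semigroup_op_def Qx.emeasure_space_1)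
  then have "ennreal (k / \<psi> x) * nn_semigroup_op P t (\<lambda>y. ennreal (\<psi> y)) x = 1"
    using *[of "\<lambda>_. 1"] by simp
  then have "ennreal (\<psi> x / k) * ennreal (k / \<psi> x) * nn_semigroup_op P t (\<lambda>y. ennreal (\<psi> y)) x = ennreal (\<psi> x / k)"
    by (simp add: mult.assoc)
  then show "nn_semigroup_op P t (\<lambda>y. ennreal (\<psi> y)) x = ennreal (\<psi> x / k)"
    using k pos[of x] by (simp add: ennreal_mult[symmetric])
qed

lemma mutually_abs_continuous_density:
  assumes "f \<in> borel_measurable M" "\<And>x. 0 < f x"
  shows "mutually_abs_continuous M (density M f)"
proof -
  have "null_sets (density M f) \<subseteq> null_sets M"
  proof
    fix A assume "A \<in> null_sets (density M f)"
    then have "A \<in> sets M" "AE x in M. x \<in> A \<longrightarrow> f x = 0"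
      using assms(1) by (auto simp: null_sets_density_iff)
    moreover then have "AE x in M. x \<notin> A"
      by (auto elim!: eventually_mono) (metis assms(2) less_irrefl)
    ultimately show "A \<in> null_sets M"
      by (simp add: AE_iff_null_sets)
  qed
  with absolutely_continuousI_density[OF assms(1)] show ?thesis
    by (simp add: mutually_abs_continuous_def absolutely_continuous_def)
qed

text \<open>In the ratio q_{t-s}(X_s,y)/q_t(x,y) the factors depending on the endpoint y cancel, and
  what remains beside the ratio of p is exactly the inverse of the h-transform weight at time
  s.\<close>

lemma bridge_law_h_transform:
  fixes \<psi> :: "'e::topological_space \<Rightarrow> real"
  assumes P: "density_process m P p" and Q: "density_process m' Q q"
    and h: "\<And>x. 0 < h x" and \<psi> [measurable]: "\<psi> \<in> borel_measurable borel" and pos: "\<And>x. 0 < \<psi> x"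
    and ker: "\<And>t x y. 0 < t \<Longrightarrow> q t x y * h y * \<psi> x = exp (- c * t) * \<psi> y * p t x y"
    and law: "\<And>t. 0 \<le> t \<Longrightarrow> restr_to_subalg (Q x) (path_sigma {0..t}) =
      density (restr_to_subalg (P x) (path_sigma {0..t}))
        (\<lambda>\<omega>. ennreal (exp (- c * t) * (\<psi> (\<omega> t) / \<psi> (\<omega> 0))))"
    and t: "0 < t" and B: "is_bridge_law P p x t y B" and B': "is_bridge_law Q q x t y B'"
  shows "B' = B"
proof (rule path_measure_eqI[where I = "{0..<t}"])
  interpret P: density_process m P p by fact
  interpret Q: density_process m' Q q by fact
  show "sets B' = sets (path_sigma {0..<t})" "sets B = sets (path_sigma {0..<t})"
    using B B' by (auto simp: is_bridge_law_def)
  show "finite_measure B'"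
    using B' by (auto simp: is_bridge_law_def prob_space_def)
  fix J :: "real set" and A :: "real \<Rightarrow> 'e set"
  assume J: "finite J" "J \<subseteq> {0..<t}" and A: "\<And>j. A j \<in> sets borel"
  \<comment> \<open>Finitely many times below \<open>t\<close> have a maximum below
    \<open>t\<close>; inserting 0 covers empty \<open>J\<close>.\<close>
  define s where "s = Max (insert 0 J)"
  have s: "0 \<le> s" "s < t" and Js: "J \<subseteq> {0..s}"
    using J t by (auto simp: s_def)
  let ?C = "path_cylinder J A"
  have C [measurable]: "?C \<in> sets (path_sigma {0..s})" using J(1) Js A by (rule path_cylinder_sets)
  have C': "?C \<in> sets (path_sigma {0..<t})" using J A by (rule path_cylinder_sets)
  have [measurable]: "(\<lambda>\<omega>. \<omega> s) \<in> measurable (path_sigma {0..s}) borel" "(\<lambda>\<omega>. \<omega> 0) \<in> measurable (path_sigma {0..s}) borel"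
    using s by (auto intro!: measurable_path_eval)
  note [measurable] = P.p_measurable2[of "t - s"] Q.p_measurable2[of "t - s"]
  have subP: "subalgebra (P x) (path_sigma {0..s})" and subQ: "subalgebra (Q x) (path_sigma {0..s})"
    by (auto intro!: subalgebra_path_sigma P.right Q.right)
  let ?d = "\<lambda>\<omega>. ennreal (exp (- c * s) * (\<psi> (\<omega> s) / \<psi> (\<omega> 0)))"
  have "emeasure B' ?C = (\<integral>\<^sup>+\<omega>. indicator ?C \<omega> \<partial>B')"
    using C' B' by (simp add: is_bridge_law_def)
  also have "\<dots> = (\<integral>\<^sup>+\<omega>. indicator ?C \<omega> * ennreal (q (t - s) (\<omega> s) y / q t x y) \<partial>Q x)"
    using s by (intro is_bridge_lawD[OF B']) auto
  also have "\<dots> = (\<integral>\<^sup>+\<omega>. indicator ?C \<omega> * ennreal (q (t - s) (\<omega> s) y / q t x y) \<partial>restr_to_subalg (Q x) (path_sigma {0..s}))"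
    using s by (intro nn_integral_subalgebra2[OF subQ, symmetric]) measurable
  also have "\<dots> = (\<integral>\<^sup>+\<omega>. ?d \<omega> * (indicator ?C \<omega> * ennreal (q (t - s) (\<omega> s) y / q t x y)) \<partial>restr_to_subalg (P x) (path_sigma {0..s}))"
    unfolding law[OF s(1)]
    using s by (intro nn_integral_density measurable_in_subalg[OF subP]) measurable
  also have "\<dots> = (\<integral>\<^sup>+\<omega>. ?d \<omega> * (indicator ?C \<omega> * ennreal (q (t - s) (\<omega> s) y / q t x y)) \<partial>P x)"
    using s by (intro nn_integral_subalgebra2[OF subP]) measurable
  also have "\<dots> = (\<integral>\<^sup>+\<omega>. indicator ?C \<omega> * ennreal (p (t - s) (\<omega> s) y / p t x y) \<partial>P x)"
  proof (rule nn_integral_cong_AE)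
    have "exp (- c * s) * (\<psi> z / \<psi> x) * (q (t - s) z y / q t x y) = p (t - s) z y / p t x y" for z
    proof -
      have "0 < t - s" using s by simp
      note pos' = pos[of z] pos[of x] P.p_pos[OF t, of x y] Q.p_pos[OF t, of x y] P.p_pos[OF this, of z y] Q.p_pos[OF this, of z y]
        pos[of y] h[of y]
      have 1: "q t x y = exp (- c * t) * \<psi> y * p t x y / (h y * \<psi> x)"
        using ker[OF t, of x y] pos' by (simp add: field_simps)
      have 2: "q (t - s) z y = exp (- c * (t - s)) * \<psi> y * p (t - s) z y / (h y * \<psi> z)"
        using ker[OF \<open>0 < t - s\<close>, of z y] pos' by (simp add: field_simps)
      have "exp (- c * t) = exp (- c * s) * exp (- c * (t - s))"
        by (simp add: mult_exp_exp algebra_simps)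
      then show ?thesis
        unfolding 1 2 using pos' by simp
    qed
    moreover have "AE \<omega> in P x. \<omega> 0 = x" using P.right by (simp add: borel_right_process_def)
    moreover have "0 < q (t - s) z y / q t x y" for z using Q.p_pos s t by simp
    ultimately show "AE \<omega> in P x. ?d \<omega> * (indicator ?C \<omega> * ennreal (q (t - s) (\<omega> s) y / q t x y)) =
        indicator ?C \<omega> * ennreal (p (t - s) (\<omega> s) y / p t x y)"
      using pos by (auto elim!: eventually_mono simp: indicator_def ennreal_mult[symmetric] less_imp_le)
  qed
  also have "\<dots> = (\<integral>\<^sup>+\<omega>. indicator ?C \<omega> \<partial>B)"
    using s by (intro is_bridge_lawD[OF B, symmetric]) auto
  also have "\<dots> = emeasure B ?C"
    using C' B by (simp add: is_bridge_law_def)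
  finally show "emeasure B' ?C = emeasure B ?C" .
qed

section \<open>What a common bridge says about reference measures and kernels\<close>

text \<open>The law of X_s under \<open>B\<close> has density \<open>kp\<close> for \<open>m\<close>
  and density \<open>kq\<close> for \<open>m'\<close>; as \<open>kq\<close> never vanishes, it can
  be divided out.\<close>

lemma reference_measure_density:
  assumes P: "density_process m P p" and Q: "density_process m' Q q"
    and B: "is_bridge_law P p x t y B" "is_bridge_law Q q x t y B" and s: "0 < s" "s < t"
  shows "m' = density m (\<lambda>z. ennreal ((p s x z * p (t - s) z y / p t x y) / (q s x z * q (t - s) z y / q t x y)))"
proof -
  interpret P: density_process m P p by fact
  interpret Q: density_process m' Q q by fact
  define kp where "kp z = p s x z * p (t - s) z y / p t x y" for z
  define kq where "kq z = q s x z * q (t - s) z y / q t x y" for z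
  have [measurable]: "kp \<in> borel_measurable borel" "kq \<in> borel_measurable borel"
    using s P.p_measurable1[of s x] P.p_measurable2[of "t - s" y] Q.p_measurable1[of s x] Q.p_measurable2[of "t - s" y]
    by (auto simp: kp_def[abs_def] kq_def[abs_def])
  have pos: "0 < kp z" "0 < kq z" for z using s P.p_pos Q.p_pos by (auto simp: kp_def kq_def)
  have eq: "density m (\<lambda>z. ennreal (kp z)) = density m' (\<lambda>z. ennreal (kq z))"
  proof (rule measure_eqI)
    fix A assume "A \<in> sets (density m (\<lambda>z. ennreal (kp z)))"
    then have "A \<in> sets borel" by simp
    then show "emeasure (density m (\<lambda>z. ennreal (kp z))) A = emeasure (density m' (\<lambda>z. ennreal (kq z))) A"
      using P.bridge_one_time[OF B(1) s, of A] Q.bridge_one_time[OF B(2) s, of A]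
      by (simp add: emeasure_density kp_def[symmetric] kq_def[symmetric])
  qed simp
  have "density m (\<lambda>z. ennreal (kp z / kq z)) = density (density m (\<lambda>z. ennreal (kp z))) (\<lambda>z. ennreal (1 / kq z))"
    using pos by (subst density_density_eq) (auto simp: ennreal_mult[symmetric] less_imp_le)
  also have "\<dots> = density m' (\<lambda>z. ennreal (kq z) * ennreal (1 / kq z))"
    unfolding eq by (subst density_density_eq) auto
  also have "\<dots> = density m' (\<lambda>_. 1)"
    using pos less_imp_neq[OF pos(2)] by (intro arg_cong[of _ _ "density m'"]) (auto simp: ennreal_mult[symmetric] less_imp_le fun_eq_iff)
  finally show ?thesis by (simp add: density_1 kp_def kq_def)
qed

text \<open>The density found at one intermediate time must serve all of them: it always represents
  the same \<open>m'\<close>, and continuity removes the null sets. In the two-time identity,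
  \<open>h\<close> occurs twice because both variables are integrated against
  \<open>m'\<close>.\<close>

lemma common_bridge_kernel_identity:
  assumes P: "density_process m P p" and Q: "density_process m' Q q"
    and p_cont: "\<And>t y. 0 < t \<Longrightarrow> continuous_on UNIV (\<lambda>x. p t x y)" "\<And>t x. 0 < t \<Longrightarrow> continuous_on UNIV (p t x)"
    and q_cont: "\<And>t y. 0 < t \<Longrightarrow> continuous_on UNIV (\<lambda>x. q t x y)" "\<And>t x. 0 < t \<Longrightarrow> continuous_on UNIV (q t x)"
    and B: "is_bridge_law P p x0 t0 y0 B" "is_bridge_law Q q x0 t0 y0 B"
    and h_cont: "continuous_on UNIV h" and h: "\<And>x. 0 < h x"
    and m': "m' = density m (\<lambda>x. ennreal (h x))"
  shows "0 < s \<Longrightarrow> s < t0 \<Longrightarrow> p s x0 x * p (t0 - s) x y0 / p t0 x0 y0 = h x * (q s x0 x * q (t0 - s) x y0 / q t0 x0 y0)"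
    and "0 < s \<Longrightarrow> s < u \<Longrightarrow> u < t0 \<Longrightarrow>
      p s x0 x * p (u - s) x y * p (t0 - u) y y0 / p t0 x0 y0 =
      h x * h y * (q s x0 x * q (u - s) x y * q (t0 - u) y y0 / q t0 x0 y0)"
proof -
  interpret P: density_process m P p by fact
  interpret Q: density_process m' Q q by fact
  have [measurable]: "h \<in> borel_measurable borel" using h_cont by (rule borel_measurable_continuous_onI)
  {
    assume s: "0 < s" "s < t0"
    then have s': "0 < t0" "0 < t0 - s" by auto
    note pos = P.p_pos[OF s(1)] P.p_pos[OF s'(1)] P.p_pos[OF s'(2)] Q.p_pos[OF s(1)] Q.p_pos[OF s'(1)] Q.p_pos[OF s'(2)]
    define h' where "h' z = (p s x0 z * p (t0 - s) z y0 / p t0 x0 y0) / (q s x0 z * q (t0 - s) z y0 / q t0 x0 y0)" for z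
    have cont: "continuous_on UNIV h'"
      unfolding h'_def
      using pos[THEN less_imp_neq] by (intro continuous_intros p_cont q_cont s s') (auto simp: eq_commute[of 0])
    have [measurable]: "h' \<in> borel_measurable borel"
      using cont by (rule borel_measurable_continuous_onI)
    have hpos: "0 < h' z" for z using pos by (simp add: h'_def)
    have "m' = density m (\<lambda>z. ennreal (h' z))"
      unfolding h'_def by (rule reference_measure_density[OF P Q B s])
    then have "AE x in m. ennreal (h x) = ennreal (h' x)"
      using m' by (intro P.density_unique) simp_all
    then have "AE x in m. h x = h' x"
      using h hpos by (simp add: less_imp_le)
    then have "h x = h' x" using h_cont cont by (rule P.continuous_AE_eq_imp_eq)
    then show "p s x0 x * p (t0 - s) x y0 / p t0 x0 y0 = h x * (q s x0 x * q (t0 - s) x y0 / q t0 x0 y0)"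
      using pos[of x0 x] pos[of x y0] pos[of x0 y0] by (simp add: h'_def field_simps)
  next
    assume s: "0 < s" "s < u" "u < t0"
    then have s': "0 < t0" "0 < t0 - u" "0 < u - s" by auto
    note pos = P.p_pos[OF s(1)] P.p_pos[OF s'(1)] P.p_pos[OF s'(2)] P.p_pos[OF s'(3)]
      Q.p_pos[OF s(1)] Q.p_pos[OF s'(1)] Q.p_pos[OF s'(2)] Q.p_pos[OF s'(3)]
    define F where "F x y = p s x0 x * p (u - s) x y * p (t0 - u) y y0 / p t0 x0 y0" for x y
    define G' where "G' x y = q s x0 x * q (u - s) x y * q (t0 - u) y y0 / q t0 x0 y0" for x y
    define G where "G x y = h x * h y * G' x y" for x y
    note [measurable] = P.p_measurable1[OF s(1)] P.p_measurable2[OF s'(2)] P.p_measurable[OF s'(3)]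
      Q.p_measurable1[OF s(1)] Q.p_measurable2[OF s'(2)] Q.p_measurable[OF s'(3)]
    have F_meas [measurable]: "(\<lambda>(x, y). F x y) \<in> borel_measurable (borel \<Otimes>\<^sub>M borel)"
      unfolding F_def by measurable
    have G'_meas [measurable]: "(\<lambda>(x, y). G' x y) \<in> borel_measurable (borel \<Otimes>\<^sub>M borel)"
      unfolding G'_def by measurable
    have G_meas [measurable]: "(\<lambda>(x, y). G x y) \<in> borel_measurable (borel \<Otimes>\<^sub>M borel)"
      unfolding G_def by measurable
    have mm: "measurable (m \<Otimes>\<^sub>M m) borel = measurable (borel \<Otimes>\<^sub>M borel) (borel :: ennreal measure)"
      by (intro measurable_cong_sets sets_pair_measure_cong) auto
    have pos': "0 < F x y" "0 < G' x y" "0 < G x y" for x y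
      using pos h by (simp_all add: F_def G_def G'_def)
    have FB: "(\<integral>\<^sup>+\<omega>. indicator A (\<omega> s) * indicator C (\<omega> u) \<partial>B) =
        (\<integral>\<^sup>+x. \<integral>\<^sup>+y. ennreal (F x y) * (indicator A x * indicator C y) \<partial>m \<partial>m)"
      if "A \<in> sets borel" "C \<in> sets borel" for A C
      unfolding F_def by (rule P.bridge_two_time[OF B(1) s that])
    have GB: "(\<integral>\<^sup>+\<omega>. indicator A (\<omega> s) * indicator C (\<omega> u) \<partial>B) =
        (\<integral>\<^sup>+x. \<integral>\<^sup>+y. ennreal (G x y) * (indicator A x * indicator C y) \<partial>m \<partial>m)"
      if [measurable]: "A \<in> sets borel" "C \<in> sets borel" for A C
    proof -
      have "(\<integral>\<^sup>+\<omega>. indicator A (\<omega> s) * indicator C (\<omega> u) \<partial>B) =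
        (\<integral>\<^sup>+x. \<integral>\<^sup>+y. ennreal (G' x y) * (indicator A x * indicator C y) \<partial>m' \<partial>m')"
        unfolding G'_def by (rule Q.bridge_two_time[OF B(2) s that])
      also have "\<dots> = (\<integral>\<^sup>+x. \<integral>\<^sup>+y. ennreal (h y) * (ennreal (G' x y) * (indicator A x * indicator C y)) \<partial>m \<partial>m')"
        unfolding m' by (intro nn_integral_cong nn_integral_density) simp_all
      also have "\<dots> = (\<integral>\<^sup>+x. ennreal (h x) * (\<integral>\<^sup>+y. ennreal (h y) * (ennreal (G' x y) * (indicator A x * indicator C y)) \<partial>m) \<partial>m)"
        unfolding m' by (intro nn_integral_density) simp_all
      also have "\<dots> = (\<integral>\<^sup>+x. \<integral>\<^sup>+y. ennreal (h x) * (ennreal (h y) * (ennreal (G' x y) * (indicator A x * indicator C y))) \<partial>m \<partial>m)"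
        by (intro nn_integral_cong nn_integral_cmult[symmetric]) simp
      also have "\<dots> = (\<integral>\<^sup>+x. \<integral>\<^sup>+y. ennreal (G x y) * (indicator A x * indicator C y) \<partial>m \<partial>m)"
        using h pos' by (intro nn_integral_cong) (simp add: G_def ennreal_mult less_imp_le mult.assoc)
      finally show ?thesis .
    qed
    have "AE x in m. AE y in m. (\<lambda>(x, y). ennreal (F x y)) (x, y) = (\<lambda>(x, y). ennreal (G x y)) (x, y)"
    proof (rule AE_eq_if_rectangle_integrals_eq)
      show "sigma_finite_measure m" by unfold_locales
      \<comment> \<open>The two-time density has total mass 1, which is the finiteness
        required.\<close>
      interpret prob_space B using B by (simp add: is_bridge_law_def)
      have "(\<integral>\<^sup>+x. \<integral>\<^sup>+y. ennreal (F x y) \<partial>m \<partial>m) = 1"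
        using FB[of UNIV UNIV] by (simp add: emeasure_space_1)
      then show "(\<integral>\<^sup>+x. \<integral>\<^sup>+y. (case (x, y) of (x, y) \<Rightarrow> ennreal (F x y)) \<partial>m \<partial>m) < \<infinity>"
        by simp
    qed (use FB GB in \<open>simp_all add: mm\<close>)
    then have "AE x in m. AE y in m. F x y = G x y"
      using pos' by (simp add: less_imp_le)
    moreover have "p t0 x0 y0 \<noteq> 0" "q t0 x0 y0 \<noteq> 0"
      using P.p_pos[OF s'(1), of x0 y0] Q.p_pos[OF s'(1), of x0 y0] by simp_all
    then have "continuous_on UNIV (F x)" "continuous_on UNIV (G x)"
      "continuous_on UNIV (\<lambda>x. F x y)" "continuous_on UNIV (\<lambda>x. G x y)" for x y
      unfolding F_def[abs_def] G_def[abs_def] G'_def[abs_def]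
      by (intro continuous_on_mult continuous_on_divide continuous_on_const p_cont q_cont h_cont s s' ballI; simp)+
    ultimately have "F x y = G x y"
      by (rule P.separately_continuous_AE_eq_imp_eq)
    then show "p s x0 x * p (u - s) x y * p (t0 - u) y y0 / p t0 x0 y0 =
      h x * h y * (q s x0 x * q (u - s) x y * q (t0 - u) y y0 / q t0 x0 y0)"
      by (simp add: F_def G_def G'_def)
  }
qed

section \<open>From short times to all times, and the exponential factor\<close>

text \<open>In Chapman-Kolmogorov for q with respect to h m, the factors psi(z) and h(z) at the
  intermediate point cancel, so the identity at t gives it at 2t. Repeated doubling exhausts all
  times.\<close>

lemma kernel_identity_extend:
  assumes P: "density_process m P p" and Q: "density_process m' Q q"
    and ck_p: "\<And>s t x y. 0 < s \<Longrightarrow> 0 < t \<Longrightarrow> ennreal (p (t + s) x y) = (\<integral>\<^sup>+z. ennreal (p t x z * p s z y) \<partial>m)"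
    and ck_q: "\<And>s t x y. 0 < s \<Longrightarrow> 0 < t \<Longrightarrow> ennreal (q (t + s) x y) = (\<integral>\<^sup>+z. ennreal (q t x z * q s z y) \<partial>m')"
    and h [measurable]: "h \<in> borel_measurable borel" and hpos: "\<And>x. 0 < h x"
    and m': "m' = density m (\<lambda>x. ennreal (h x))" and pos: "\<And>x. 0 < \<psi> x"
    and a: "0 < a" and ker: "\<And>t x y. 0 < t \<Longrightarrow> t < a \<Longrightarrow> q t x y * h y * \<psi> x = exp (- c * t) * \<psi> y * p t x y"
    and t: "0 < t"
  shows "q t x y * h y * \<psi> x = exp (- c * t) * \<psi> y * p t x y"
proof -
  interpret P: density_process m P p by fact
  interpret Q: density_process m' Q q by fact
  have double: "q (t + t) x y * h y * \<psi> x = exp (- c * (t + t)) * \<psi> y * p (t + t) x y"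
    if t: "0 < t" and *: "\<And>x y. q t x y * h y * \<psi> x = exp (- c * t) * \<psi> y * p t x y" for t x y
  proof -
    have t2: "0 < t + t" using t by simp
    note [measurable] = P.p_measurable1[OF t] P.p_measurable2[OF t] Q.p_measurable1[OF t] Q.p_measurable2[OF t]
    have q_eq: "q t x y = exp (- c * t) * \<psi> y * p t x y / (h y * \<psi> x)" for x y
      using *[of x y] hpos[of y] pos[of x] by (simp add: field_simps)
    let ?k = "exp (- c * (t + t)) * \<psi> y / (\<psi> x * h y)"
    have k: "0 < ?k" using pos hpos by simp
    have "ennreal (q (t + t) x y) = (\<integral>\<^sup>+z. ennreal (q t x z * q t z y) \<partial>m')"
      by (rule ck_q[OF t t])
    also have "\<dots> = (\<integral>\<^sup>+z. ennreal (h z) * ennreal (q t x z * q t z y) \<partial>m)"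
      unfolding m' by (rule nn_integral_density) simp_all
    also have "\<dots> = (\<integral>\<^sup>+z. ennreal ?k * ennreal (p t x z * p t z y) \<partial>m)"
    proof (rule nn_integral_cong)
      fix z
      have "h z * (q t x z * q t z y) = ?k * (p t x z * p t z y)"
        unfolding q_eq using hpos[of z] hpos[of y] pos[of x] pos[of z]
        by (simp add: field_simps exp_add[symmetric])
      then show "ennreal (h z) * ennreal (q t x z * q t z y) = ennreal ?k * ennreal (p t x z * p t z y)"
        using k hpos[of z] P.p_pos[OF t] Q.p_pos[OF t]
        by (simp only: ennreal_mult[symmetric] less_imp_le mult_pos_pos)
    qed
    also have "\<dots> = ennreal ?k * ennreal (p (t + t) x y)"
      unfolding ck_p[OF t t] by (rule nn_integral_cmult) simp
    also have "\<dots> = ennreal (?k * p (t + t) x y)"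
      using k P.p_pos[OF t2, of x y] by (simp only: ennreal_mult[symmetric] less_imp_le)
    finally have "q (t + t) x y = ?k * p (t + t) x y"
      using k P.p_pos[OF t2, of x y] Q.p_pos[OF t2, of x y] by (simp only: ennreal_inj less_imp_le mult_pos_pos)
    then show ?thesis using pos[of x] hpos[of y] by (simp add: field_simps)
  qed
  have "\<forall>t x y. 0 < t \<longrightarrow> t < 2 ^ n * a \<longrightarrow> q t x y * h y * \<psi> x = exp (- c * t) * \<psi> y * p t x y" for n
  proof (induction n)
    case 0
    then show ?case using ker by simp
  next
    case (Suc n)
    show ?case
    proof (intro allI impI)
      fix t x y assume "0 < t" "t < 2 ^ Suc n * a"
      then have "0 < t / 2" "t / 2 < 2 ^ n * a" by auto
      with Suc.IH double[of "t / 2" x y]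
      show "q t x y * h y * \<psi> x = exp (- c * t) * \<psi> y * p t x y" by simp
    qed
  qed
  moreover obtain n where "t / a < 2 ^ n" using real_arch_pow[of 2 "t / a"] by auto
  ultimately show ?thesis using t a by (auto simp: field_simps)
qed

text \<open>Since P_u psi = psi/g(u), the Fatou bound says that -log g is asymptotically nonnegative
  at 0, the only regularity that the additive equation needs.\<close>

lemma h_transform_factor_exponential:
  assumes P: "density_process m P p" and Q: "density_process m' Q q"
    and h: "h \<in> borel_measurable borel" "\<And>x. 0 < h x"
    and m': "m' = density m (\<lambda>x. ennreal (h x))"
    and \<psi>: "continuous_on UNIV \<psi>" "\<And>x. 0 < \<psi> x" and a: "0 < a"
    and g: "\<And>u. 0 < u \<Longrightarrow> u < a \<Longrightarrow> 0 < g u"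
    and mult: "\<And>u v. 0 < u \<Longrightarrow> 0 < v \<Longrightarrow> u + v < a \<Longrightarrow> g (u + v) = g u * g v"
    and ker: "\<And>u x y. 0 < u \<Longrightarrow> u < a \<Longrightarrow> q u x y * h y * \<psi> x = g u * \<psi> y * p u x y"
  obtains c where "\<And>u. 0 < u \<Longrightarrow> u < a / 2 \<Longrightarrow> g u = exp (- c * u)"
proof -
  have P_right: "borel_right_process P" using P by (simp add: density_process_def density_process_axioms_def)
  have \<psi>_meas: "\<psi> \<in> borel_measurable borel" using \<psi>(1) by (rule borel_measurable_continuous_onI)
  have "eventually (\<lambda>u. - \<epsilon> \<le> - ln (g u)) (at_right 0)" if \<epsilon>: "0 < \<epsilon>" for \<epsilon>
  \<comment> \<open>Fatou works along sequences, hence the sequential criterion.\<close>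
  proof (rule sequentially_imp_eventually_within, safe)
    fix u :: "nat \<Rightarrow> real" assume "\<forall>n. u n \<in> {0<..} \<and> u n \<noteq> 0" and lim: "u \<longlonglongrightarrow> 0"
    then have u: "0 < u n" for n by simp
    \<comment> \<open>Any single point will do, since g(u) does not depend on it. Lowering psi(x) by
      the factor exp(-\<epsilon>) gives the strict inequality that passes from the liminf to
      eventual terms.\<close>
    fix x :: 'a
    have "ennreal (exp (- \<epsilon>) * \<psi> x) < ennreal (\<psi> x)"
      using \<psi>(2)[of x] \<epsilon> by (intro ennreal_lessI) auto
    also have "\<dots> \<le> liminf (\<lambda>n. nn_semigroup_op P (u n) (\<lambda>z. ennreal (\<psi> z)) x)"
      using P_right \<psi>(1) lim u by (rule borel_right_process_liminf)
    finally have "eventually (\<lambda>n. ennreal (exp (- \<epsilon>) * \<psi> x) < nn_semigroup_op P (u n) (\<lambda>z. ennreal (\<psi> z)) x) sequentially"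
      by (rule less_LiminfD)
    moreover have "eventually (\<lambda>n. u n < a) sequentially"
      using lim a by (rule order_tendstoD(2))
    ultimately show "eventually (\<lambda>n. - \<epsilon> \<le> - ln (g (u n))) sequentially"
    proof eventually_elim
      case (elim n)
      note gu = g[OF u elim(2)]
      have "ennreal (exp (- \<epsilon>) * \<psi> x) < ennreal (\<psi> x / g (u n))"
        using elim semigroup_op_h_transform(2)[OF P Q h m' \<psi>_meas \<psi>(2) u gu ker[OF u elim(2)]] by simp
      then have "exp (- \<epsilon>) * g (u n) < 1"
        using \<psi>(2)[of x] gu by (simp add: ennreal_less_iff field_simps)
      then have "g (u n) < exp \<epsilon>" by (simp add: exp_minus field_simps)
      then have "ln (g (u n)) < \<epsilon>" using gu by (metis ln_exp ln_less_cancel_iff exp_gt_zero)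
      then show ?case by simp
    qed
  qed
  moreover have "- ln (g (u + v)) = - ln (g u) + - ln (g v)" if "0 < u" "0 < v" "u + v < a" for u v
    using mult[OF that] g[of u] g[of v] that by (simp add: ln_mult)
  ultimately obtain c where c: "\<And>u. 0 < u \<Longrightarrow> u < a / 2 \<Longrightarrow> - ln (g u) = c * u"
    using locally_additive_imp_linear[OF a, of "\<lambda>u. - ln (g u)"] by metis
  show ?thesis
  proof (rule that[of c])
    fix u assume u: "0 < u" "u < a / 2"
    then have "g u = exp (ln (g u))" using g[of u] by simp
    also have "ln (g u) = - c * u" using c[OF u] by simp
    finally show "g u = exp (- c * u)" .
  qed
qed

section \<open>Assembly: the two h-transforms, equivalence of laws and equality of bridges\<close>

theorem mainTheorem2:
  fixes K B :: "'k::metric_space set"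
    and P P' Q Q' :: "'e::topological_space \<Rightarrow> (real \<Rightarrow> 'e) measure"
    and mX mY :: "'e measure"
    and p q :: "real \<Rightarrow> 'e \<Rightarrow> 'e \<Rightarrow> real"
    and PB QB :: "'e \<Rightarrow> real \<Rightarrow> 'e \<Rightarrow> (real \<Rightarrow> 'e) measure"
  assumes state_space: "compact K" "B \<subseteq> K" "B \<in> sets borel" "(UNIV :: 'e set) homeomorphic B"
    and X: "borel_right_process P" "duality_hyp P P' mX" "transition_density_hyp P P' mX p"
    and Y: "borel_right_process Q" "duality_hyp Q Q' mY" "transition_density_hyp Q Q' mY q"
    and bridge_X: "\<And>x t y. 0 < t \<Longrightarrow> is_bridge_law P p x t y (PB x t y)"
    and bridge_Y: "\<And>x t y. 0 < t \<Longrightarrow> is_bridge_law Q q x t y (QB x t y)"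
    and p_cont: "\<And>t y. 0 < t \<Longrightarrow> continuous_on UNIV (\<lambda>x. p t x y)"
                "\<And>t x. 0 < t \<Longrightarrow> continuous_on UNIV (\<lambda>y. p t x y)"
    and q_cont: "\<And>t y. 0 < t \<Longrightarrow> continuous_on UNIV (\<lambda>x. q t x y)"
                "\<And>t x. 0 < t \<Longrightarrow> continuous_on UNIV (\<lambda>y. q t x y)"
    and common_bridge: "\<exists>x\<^sub>0 t\<^sub>0 y\<^sub>0. 0 < t\<^sub>0 \<and> PB x\<^sub>0 t\<^sub>0 y\<^sub>0 = QB x\<^sub>0 t\<^sub>0 y\<^sub>0"
  shows
    "(\<forall>x y. \<forall>t>0.
        mutually_abs_continuous (restr_to_subalg (P x) (path_sigma {0..t}))
                                (restr_to_subalg (Q x) (path_sigma {0..t})) \<and>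
        mutually_abs_continuous (restr_to_subalg (P' y) (path_sigma {0..t}))
                                (restr_to_subalg (Q' y) (path_sigma {0..t}))) \<and>
     (\<exists>(c::real) (\<psi>::'e \<Rightarrow> real) (\<psi>'::'e \<Rightarrow> real).
        \<psi> \<in> borel_measurable borel \<and> (\<forall>x. 0 < \<psi> x) \<and> finely_continuous P \<psi> \<and>
        \<psi>' \<in> borel_measurable borel \<and> (\<forall>x. 0 < \<psi>' x) \<and> finely_continuous P' \<psi>' \<and>
        (\<forall>t>0. \<forall>x.
           nn_semigroup_op P t (\<lambda>z. ennreal (\<psi> z)) x = ennreal (exp (c * t) * \<psi> x) \<and>
           nn_semigroup_op P' t (\<lambda>z. ennreal (\<psi>' z)) x = ennreal (exp (c * t) * \<psi>' x) \<and>
           restr_to_subalg (Q x) (path_sigma {0..t}) =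
             density (restr_to_subalg (P x) (path_sigma {0..t}))
               (\<lambda>\<omega>. ennreal (exp (- c * t) * (\<psi> (\<omega> t) / \<psi> (\<omega> 0)))) \<and>
           restr_to_subalg (Q' x) (path_sigma {0..t}) =
             density (restr_to_subalg (P' x) (path_sigma {0..t}))
               (\<lambda>\<omega>. ennreal (exp (- c * t) * (\<psi>' (\<omega> t) / \<psi>' (\<omega> 0))))) \<and>
        mY = density mX (\<lambda>x. ennreal (\<psi> x * \<psi>' x))) \<and>
     (\<forall>x y. \<forall>t>0. QB x t y = PB x t y)"
proof -
  obtain x0 t0 y0 where t0: "0 < t0" and eq: "PB x0 t0 y0 = QB x0 t0 y0"
    using common_bridge by blast
  note dP = density_process_primal[OF X]
  note dQ = density_process_primal[OF Y]
  note dP' = density_process_dual[OF X(2,3)]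
  note dQ' = density_process_dual[OF Y(2,3)]
  interpret P: density_process mX P p by (rule dP)
  interpret Q: density_process mY Q q by (rule dQ)
  have bridges: "is_bridge_law P p x0 t0 y0 (PB x0 t0 y0)" "is_bridge_law Q q x0 t0 y0 (PB x0 t0 y0)"
    using bridge_X[OF t0] bridge_Y[OF t0] eq by metis+
  have half: "0 < t0 / 2" "t0 / 2 < t0" "0 < t0 - t0 / 2" using t0 by auto
  note pos = P.p_pos[OF half(1)] P.p_pos[OF half(3)] P.p_pos[OF t0]
    Q.p_pos[OF half(1)] Q.p_pos[OF half(3)] Q.p_pos[OF t0]
  \<comment> \<open>The density of \<open>mY\<close> read off at the midpoint t0/2; every other
    intermediate time yields the same function.\<close>
  define h where "h x = (p (t0/2) x0 x * p (t0 - t0/2) x y0 / p t0 x0 y0) /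
    (q (t0/2) x0 x * q (t0 - t0/2) x y0 / q t0 x0 y0)" for x
  have hpos: "0 < h x" for x using pos by (simp add: h_def)
  have h_cont: "continuous_on UNIV h"
    unfolding h_def[abs_def] using pos[THEN less_imp_neq, THEN not_sym]
    by (intro continuous_on_mult continuous_on_divide continuous_on_const p_cont q_cont half ballI) simp_all
  have h_meas: "h \<in> borel_measurable borel" using h_cont by (rule borel_measurable_continuous_onI)
  have mY: "mY = density mX (\<lambda>x. ennreal (h x))"
    unfolding h_def by (rule reference_measure_density[OF dP dQ bridges half(1,2)])
  define \<psi> where "\<psi> x = h x * (q (t0/2) x0 x / p (t0/2) x0 x)" for x
  \<comment> \<open>Forced by the requirement that the product of the two eigenfunctions be
    dm^Y/dm^X.\<close>
  define \<psi>' where "\<psi>' x = h x / \<psi> x" for x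
  have \<psi>_pos: "0 < \<psi> x" for x using pos hpos by (simp add: \<psi>_def)
  have \<psi>'_pos: "0 < \<psi>' x" for x using \<psi>_pos hpos by (simp add: \<psi>'_def)
  have \<psi>_cont: "continuous_on UNIV \<psi>"
    unfolding \<psi>_def[abs_def] using pos[THEN less_imp_neq, THEN not_sym]
    by (intro continuous_on_mult continuous_on_divide h_cont p_cont q_cont half ballI) simp_all
  have \<psi>'_cont: "continuous_on UNIV \<psi>'"
    unfolding \<psi>'_def[abs_def] using \<psi>_pos[THEN less_imp_neq, THEN not_sym]
    by (intro continuous_on_divide h_cont \<psi>_cont ballI) simp_all
  have \<psi>_meas: "\<psi> \<in> borel_measurable borel" "\<psi>' \<in> borel_measurable borel"
    using \<psi>_cont \<psi>'_cont by (auto intro: borel_measurable_continuous_onI)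
  note identity = common_bridge_kernel_identity[OF dP dQ p_cont q_cont bridges h_cont hpos mY]
  obtain g where g: "\<And>u. 0 < u \<Longrightarrow> u < t0 \<Longrightarrow> 0 < g u"
    and g_mult: "\<And>u v. 0 < u \<Longrightarrow> 0 < v \<Longrightarrow> u + v < t0 \<Longrightarrow> g (u + v) = g u * g v"
    and g_ker: "\<And>u x y. 0 < u \<Longrightarrow> u < t0 \<Longrightarrow> q u x y * h y * \<psi> x = g u * \<psi> y * p u x y"
    using kernel_ratio_factorization[OF t0 P.p_pos Q.p_pos hpos identity(1,2), folded \<psi>_def] by blast
  obtain c where c: "\<And>u. 0 < u \<Longrightarrow> u < t0 / 2 \<Longrightarrow> g u = exp (- c * u)"
    using h_transform_factor_exponential[OF dP dQ h_meas hpos mY \<psi>_cont \<psi>_pos t0 g g_mult g_ker] by blast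
  have ck: "ennreal (p (t + s) x y) = (\<integral>\<^sup>+z. ennreal (p t x z * p s z y) \<partial>mX)"
    "ennreal (q (t + s) x y) = (\<integral>\<^sup>+z. ennreal (q t x z * q s z y) \<partial>mY)" if "0 < s" "0 < t" for s t x y
    using X(3) Y(3) that by (simp_all add: transition_density_hyp_def)
  have ker_small: "q u x y * h y * \<psi> x = exp (- c * u) * \<psi> y * p u x y" if "0 < u" "u < t0 / 2" for u x y
    using g_ker[of u x y] c[OF that] that t0 by simp
  have ker: "q t x y * h y * \<psi> x = exp (- c * t) * \<psi> y * p t x y" if "0 < t" for t x y
    using dP dQ ck h_meas hpos mY \<psi>_pos half(1) ker_small that by (rule kernel_identity_extend)
  \<comment> \<open>Transposition exchanges the roles of psi and h/psi, with \<open>h\<close> and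
    \<open>c\<close> unchanged, so all lemmas apply again to the duals.\<close>
  have ker': "q t y x * h y * \<psi>' x = exp (- c * t) * \<psi>' y * p t y x" if "0 < t" for t x y
    using ker[OF that, of y x] \<psi>_pos[of x] \<psi>_pos[of y]
    by (simp add: \<psi>'_def field_simps)
  \<comment> \<open>Here k = exp(-c t), so the eigenvalue 1/k is exp(c t): \<open>c\<close> is the
    constant lambda, with its sign.\<close>
  have eigen: "nn_semigroup_op P t (\<lambda>z. ennreal (\<psi> z)) x = ennreal (exp (c * t) * \<psi> x)"
    "nn_semigroup_op P' t (\<lambda>z. ennreal (\<psi>' z)) x = ennreal (exp (c * t) * \<psi>' x)" if "0 < t" for t x
    using semigroup_op_h_transform(2)[OF dP dQ h_meas hpos mY \<psi>_meas(1) \<psi>_pos that exp_gt_zero ker[OF that], of x]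
      semigroup_op_h_transform(2)[OF dP' dQ' h_meas hpos mY \<psi>_meas(2) \<psi>'_pos that exp_gt_zero ker'[OF that], of x]
    by (simp_all add: exp_minus field_simps)
  have law: "restr_to_subalg (Q x) (path_sigma {0..t}) = density (restr_to_subalg (P x) (path_sigma {0..t}))
      (\<lambda>\<omega>. ennreal (exp (- c * t) * (\<psi> (\<omega> t) / \<psi> (\<omega> 0))))" if "0 \<le> t" for t x
    by (intro h_transform_law[OF dP dQ \<psi>_meas(1) \<psi>_pos] that
        semigroup_op_h_transform(1)[OF dP dQ h_meas hpos mY \<psi>_meas(1) \<psi>_pos _ exp_gt_zero ker])
  have law': "restr_to_subalg (Q' x) (path_sigma {0..t}) = density (restr_to_subalg (P' x) (path_sigma {0..t}))
      (\<lambda>\<omega>. ennreal (exp (- c * t) * (\<psi>' (\<omega> t) / \<psi>' (\<omega> 0))))" if "0 \<le> t" for t x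
    by (intro h_transform_law[OF dP' dQ' \<psi>_meas(2) \<psi>'_pos] that
        semigroup_op_h_transform(1)[OF dP' dQ' h_meas hpos mY \<psi>_meas(2) \<psi>'_pos _ exp_gt_zero ker'])
  have P'_right: "borel_right_process P'" using X(2) by (simp add: duality_hyp_def)
  \<comment> \<open>Both equivalences come from strict positivity of the h-transform weight;
    \<open>R\<close> stands for the process or its dual.\<close>
  have abs_cont: "mutually_abs_continuous (restr_to_subalg (R x) (path_sigma {0..t}))
      (density (restr_to_subalg (R x) (path_sigma {0..t})) (\<lambda>\<omega>. ennreal (exp (- c * t) * (\<phi> (\<omega> t) / \<phi> (\<omega> 0)))))"
    if R: "borel_right_process R" and [measurable]: "\<phi> \<in> borel_measurable borel" and \<phi>: "\<And>x. 0 < \<phi> x" and t: "0 < t"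
    for R :: "'e \<Rightarrow> (real \<Rightarrow> 'e) measure" and \<phi> x t
  proof (rule mutually_abs_continuous_density)
    have [measurable]: "(\<lambda>\<omega>. \<omega> t) \<in> measurable (path_sigma {0..t}) (borel :: 'e measure)"
      "(\<lambda>\<omega>. \<omega> 0) \<in> measurable (path_sigma {0..t}) (borel :: 'e measure)"
      using t by (auto intro!: measurable_path_eval)
    show "(\<lambda>\<omega>. ennreal (exp (- c * t) * (\<phi> (\<omega> t) / \<phi> (\<omega> 0)))) \<in>
        borel_measurable (restr_to_subalg (R x) (path_sigma {0..t}))"
      by (intro measurable_in_subalg[OF subalgebra_path_sigma[OF R]]) (auto, measurable)
  qed (use \<phi> in simp)
  have "mutually_abs_continuous (restr_to_subalg (P x) (path_sigma {0..t})) (restr_to_subalg (Q x) (path_sigma {0..t}))"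
    "mutually_abs_continuous (restr_to_subalg (P' x) (path_sigma {0..t})) (restr_to_subalg (Q' x) (path_sigma {0..t}))"
    if "0 < t" for x t
    unfolding law[OF less_imp_le[OF that]] law'[OF less_imp_le[OF that]]
    by (rule abs_cont[OF X(1) \<psi>_meas(1) \<psi>_pos that], rule abs_cont[OF P'_right \<psi>_meas(2) \<psi>'_pos that])
  moreover have "mY = density mX (\<lambda>x. ennreal (\<psi> x * \<psi>' x))"
    using mY \<psi>_pos[THEN less_imp_neq, THEN not_sym] by (simp add: \<psi>'_def)
  moreover have "QB x t y = PB x t y" if "0 < t" for x t y
    by (rule bridge_law_h_transform[OF dP dQ hpos \<psi>_meas(1) \<psi>_pos ker law that bridge_X[OF that] bridge_Y[OF that]])
  moreover have "finely_continuous P \<psi>" "finely_continuous P' \<psi>'"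
    using X(1) P'_right \<psi>_cont \<psi>'_cont by (auto intro: finely_continuous_continuous)
  ultimately show ?thesis
    using eigen law law' \<psi>_meas \<psi>_pos \<psi>'_pos
    by (intro conjI allI impI exI[of _ c] exI[of _ \<psi>] exI[of _ \<psi>']) (simp_all only: less_imp_le)
qed

end
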